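(* Let $p_0 \geq 1$ and let $\delta(n) \neq 0$ be efficiently computable and converge to zero as $n \to \infty$. There is an efficient algorithm that takes as input an integer $k \geq 2$ and a sufficiently large positive integer $n$ and outputs a matrix $V \in \mathbb{R}^{2^k \times k}$ and vector $\vec{t}^* \in \mathbb{R}^{2^k}$ that define a $(p_0 + \delta(n),k)$-isolating parallelepiped.
   Context: For $p\ge1$, $V\in\mathbb{R}^{d^*\times k}$ and $\vec t^*\in\mathbb{R}^{d^*}$ define a $(p,k)$-isolating parallelepiped if $\|\vec t^*\|_p>1$ and $\|V\vec x-\vec t^*\|_p=1$ for all $\vec x\in\{0,1\}^k\setminus\{\vec 0_k\}$, where $\|\vec x\|_p=(\sum_i|x_i|^p)^{1/p}$. *)

theory Defs
  imports Complex_Main "Jordan_Normal_Form.Matrix"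
begin

section \<open>Isolating parallelepipeds\<close>

definition lp_norm :: "real \<Rightarrow> real vec \<Rightarrow> real" where
  "lp_norm p v = (\<Sum>i<dim_vec v. \<bar>v $ i\<bar> powr p) powr (1 / p)"

text \<open>The notion is meant for \<open>p \<ge> 1\<close>; for \<open>0 < p < 1\<close> the same formula is used.\<close>

definition isolating_parallelepiped :: "real \<Rightarrow> nat \<Rightarrow> real mat \<Rightarrow> real vec \<Rightarrow> bool" where
  "isolating_parallelepiped p k V t \<longleftrightarrow>
     dim_col V = k \<and> dim_vec t = dim_row V \<and>
     lp_norm p t > 1 \<and>
     (\<forall>x \<in> carrier_vec k. (\<forall>i<k. x $ i \<in> {0, 1}) \<and> x \<noteq> 0\<^sub>v k
        \<longrightarrow> lp_norm p (V *\<^sub>v x - t) = 1)"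

section \<open>A real random access machine\<close>

text \<open>
  Algorithms that output real numbers are programs for a unit-cost real RAM with the analytic
  functions exp and ln, so that powers and roots \<open>x powr y = exp (y * ln x)\<close> with \<open>x > 0\<close> can be
  computed. A state consists of natural-number registers, which serve for control and
  addressing, and of a random access memory of exact real numbers. Natural numbers can only be
  added and subtracted (truncated at 0), so they cannot grow by more than a constant number of
  bits per step. There is no rounding from reals to natural numbers.

  The parameter \<open>'r\<close> is the type of the real constants occurring in a program; the generated
  function \<open>com_reals\<close> collects them. The other constants are natural numbers.
\<close>

type_synonym state = "(nat \<Rightarrow> nat) \<times> (nat \<Rightarrow> real)"

datatype nexp = NConst nat | NReg nat | NPlus nexp nexp | NMinus nexp nexp

datatype (rexp_reals: 'r) rexp =
    RConst 'r
  | ROfNat nexp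
  | RLoad nexp
  | RPlus "'r rexp" "'r rexp"
  | RMinus "'r rexp" "'r rexp"
  | RTimes "'r rexp" "'r rexp"
  | RDivide "'r rexp" "'r rexp"
  | RExp "'r rexp"
  | RLn "'r rexp"

datatype (bexp_reals: 'r) bexp =
    NLess nexp nexp
  | RLess "'r rexp" "'r rexp"
  | BNot "'r bexp"
  | BAnd "'r bexp" "'r bexp"

datatype (com_reals: 'r) com =
    Skip
  | Assign nat nexp
  | Store nexp "'r rexp"
  | Seq "'r com" "'r com"
  | If "'r bexp" "'r com" "'r com"
  | While "'r bexp" "'r com"

primrec nval :: "nexp \<Rightarrow> state \<Rightarrow> nat" where
  "nval (NConst m) s = m"
| "nval (NReg i) s = fst s i"
| "nval (NPlus a b) s = nval a s + nval b s"
| "nval (NMinus a b) s = nval a s - nval b s"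

text \<open>Division by 0 yields 0, and \<open>RLn\<close> is the logarithm of the absolute value, with value 0 at 0.\<close>

primrec rval :: "real rexp \<Rightarrow> state \<Rightarrow> real" where
  "rval (RConst c) s = c"
| "rval (ROfNat a) s = real (nval a s)"
| "rval (RLoad a) s = snd s (nval a s)"
| "rval (RPlus a b) s = rval a s + rval b s"
| "rval (RMinus a b) s = rval a s - rval b s"
| "rval (RTimes a b) s = rval a s * rval b s"
| "rval (RDivide a b) s = rval a s / rval b s"
| "rval (RExp a) s = exp (rval a s)"
| "rval (RLn a) s = (if rval a s = 0 then 0 else ln \<bar>rval a s\<bar>)"

primrec bval :: "real bexp \<Rightarrow> state \<Rightarrow> bool" where
  "bval (NLess a b) s \<longleftrightarrow> nval a s < nval b s"
| "bval (RLess a b) s \<longleftrightarrow> rval a s < rval b s"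
| "bval (BNot b) s \<longleftrightarrow> \<not> bval b s"
| "bval (BAnd b c) s \<longleftrightarrow> bval b s \<and> bval c s"

text \<open>
  \<open>exec c s T s'\<close>: program \<open>c\<close> started in \<open>s\<close> terminates in \<open>s'\<close> after \<open>T\<close> steps. Evaluating an
  expression is charged as part of one step, since the expressions of a program have fixed size.
\<close>

inductive exec :: "real com \<Rightarrow> state \<Rightarrow> nat \<Rightarrow> state \<Rightarrow> bool" where
  Skip: "exec Skip s 1 s"
| Assign: "exec (Assign i a) s 1 ((fst s)(i := nval a s), snd s)"
| Store: "exec (Store a r) s 1 (fst s, (snd s)(nval a s := rval r s))"
| Seq: "exec c1 s1 T1 s2 \<Longrightarrow> exec c2 s2 T2 s3 \<Longrightarrow> exec (Seq c1 c2) s1 (T1 + T2) s3"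
| IfTrue: "bval b s \<Longrightarrow> exec c1 s T s' \<Longrightarrow> exec (If b c1 c2) s (T + 1) s'"
| IfFalse: "\<not> bval b s \<Longrightarrow> exec c2 s T s' \<Longrightarrow> exec (If b c1 c2) s (T + 1) s'"
| WhileFalse: "\<not> bval b s \<Longrightarrow> exec (While b c) s 1 s"
| WhileTrue: "bval b s1 \<Longrightarrow> exec c s1 T1 s2 \<Longrightarrow> exec (While b c) s2 T2 s3 \<Longrightarrow>
    exec (While b c) s1 (T1 + T2 + 1) s3"

inductive_cases SkipE: "exec Skip s T s'"
  and AssignE: "exec (Assign i a) s T s'"
  and StoreE: "exec (Store a r) s T s'"
  and SeqE: "exec (Seq c1 c2) s T s'"
  and IfE: "exec (If b c1 c2) s T s'"
  and WhileE: "exec (While b c) s T s'"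

lemma exec_deterministic:
  "exec c s T s' \<Longrightarrow> exec c s U s'' \<Longrightarrow> T = U \<and> s' = s''"
proof (induction arbitrary: U s'' rule: exec.induct)
  case (Seq c1 s1 T1 s2 c2 T2 s3)
  from Seq.prems show ?case
  proof (rule SeqE)
    fix U1 u U2
    assume *: "U = U1 + U2" "exec c1 s1 U1 u" "exec c2 u U2 s''"
    with Seq.IH(1)[OF *(2)] Seq.IH(2) show ?thesis by auto
  qed
next
  case (WhileTrue b s1 c T1 s2 T2 s3)
  from WhileTrue.prems show ?case
  proof (rule WhileE)
    fix U1 u U2
    assume *: "U = Suc (U1 + U2)" "exec c s1 U1 u" "exec (While b c) u U2 s''"
    with WhileTrue.IH(1)[OF *(2)] WhileTrue.IH(2) show ?thesis by auto
  qed (use WhileTrue.hyps in simp)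
next
  case WhileFalse
  from WhileFalse.prems show ?case by (rule WhileE) (use WhileFalse.hyps in simp_all)
next
  case (IfTrue b s c1 T s' c2)
  from IfTrue.prems show ?case
  proof (rule IfE)
    fix U1
    assume *: "U = Suc U1" "exec c1 s U1 s''"
    with IfTrue.IH[OF *(2)] show ?thesis by simp
  qed (use IfTrue.hyps in simp)+
next
  case (IfFalse b s c2 T s' c1)
  from IfFalse.prems show ?case
  proof (rule IfE)
    fix U1
    assume *: "U = Suc U1" "exec c2 s U1 s''"
    with IfFalse.IH[OF *(2)] show ?thesis by simp
  qed (use IfFalse.hyps in simp)+
qed (auto elim: SkipE AssignE StoreE)

text \<open>Inputs are placed in the first registers; everything else is initially 0.\<close>

definition init_state :: "nat list \<Rightarrow> state" where
  "init_state xs = ((\<lambda>i. if i < length xs then xs ! i else 0), (\<lambda>_. 0))"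

definition out_real :: "state \<Rightarrow> real" where
  "out_real s = snd s 0"

text \<open>A matrix is stored row by row, directly followed by a vector.\<close>

definition out_mat :: "nat \<Rightarrow> nat \<Rightarrow> state \<Rightarrow> real mat" where
  "out_mat d k s = mat d k (\<lambda>(i, j). snd s (i * k + j))"

definition out_vec :: "nat \<Rightarrow> nat \<Rightarrow> state \<Rightarrow> real vec" where
  "out_vec d k s = vec d (\<lambda>i. snd s (d * k + i))"

text \<open>
  A sequence of reals, indexed by positive integers, is efficiently computable over the set \<open>K\<close>
  of real constants if its \<open>n\<close>-th term can be computed in time polynomial in \<open>n\<close> by a program
  whose real constants belong to \<open>K\<close>. For \<open>K = UNIV\<close> this allows arbitrary real constants,
  as in the Blum-Shub-Smale model.
\<close>

definition efficiently_computable :: "real set \<Rightarrow> (nat \<Rightarrow> real) \<Rightarrow> bool" where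
  "efficiently_computable K f \<longleftrightarrow>
     (\<exists>A e. com_reals A \<subseteq> K \<and>
        (\<forall>n>0. \<exists>T s. exec A (init_state [n]) T s \<and> T \<le> e * n ^ e \<and> out_real s = f n))"

end

theory Submission
  imports Defs
begin

text \<open>
  The rows of \<open>V\<close> are the sign vectors \<open>v \<in> {1, -1}\<^sup>k\<close>, each multiplied by \<open>-2 c\<^sub>v\<close>, and \<open>t\<^sup>*\<close> has
  entries \<open>c\<^sub>v h(v)\<close>, where \<open>h(v) = 1 + 2 #{b. v\<^sub>b = -1}\<close>. Writing \<open>x \<in> {0, 1}\<^sup>k\<close> as a sign vector \<open>y\<close>,
  the entries of \<open>V x - t\<^sup>*\<close> are \<open>- c\<^sub>v h(v y)\<close> with the componentwise product \<open>v y\<close>. Hence the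
  \<open>p\<close>-th power of the norm is a convolution on the group \<open>{1, -1}\<^sup>k\<close> of the weights \<open>c\<^sub>v powr p\<close>
  with \<open>h powr p\<close>. Constant weights make it constant, and a small multiple of the
  convolution inverse of \<open>h powr p\<close> increases it at \<open>x = 0\<close> only. This inverse exists because no
  Fourier coefficient of \<open>h powr p\<close> vanishes: the coefficients are mixed sums and differences of a power
  function, and the derivatives of \<open>u powr p\<close> have no zeros if \<open>p\<close> is not an integer. For large \<open>n\<close> the
  number \<open>p\<^sub>0 + \<delta> n\<close> is not an integer. Two Walsh transforms compute the weights explicitly.
\<close>

unbundle bit_operations_syntax

section \<open>Weights for the sign matrix\<close>

definition bsign :: "nat \<Rightarrow> nat \<Rightarrow> real" where
  "bsign i b = (if bit i b then -1 else 1)"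

lemma bsign_cases: "bsign i b = 1 \<or> bsign i b = -1"
  by (simp add: bsign_def)

lemma bsign_xor: "bsign (i XOR j) b = bsign i b * bsign j b"
  by (simp add: bsign_def bit_xor_iff)

lemma bsign_0 [simp]: "bsign 0 b = 1"
  by (simp add: bsign_def)

lemma bsign_less: "i < 2 ^ b \<Longrightarrow> bsign i b = 1"
  by (simp add: bsign_def bit_iff_odd)

text \<open>Subtracting \<open>2 ^ b\<close> lowers the quotient by \<open>2 ^ b\<close> by one and
  flips its parity. The machine has no bit operations; its sign table is filled by this
  recurrence.\<close>

lemma bsign_ge: "2 ^ b \<le> i \<Longrightarrow> bsign i b = - bsign (i - 2 ^ b) b"
  by (simp add: bsign_def bit_iff_odd le_div_geq)

lemma bsign_add_less:
  assumes "b < k" shows "bsign (i + 2 ^ k) b = bsign i b"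
proof -
  have "(2::nat) ^ k = 2 ^ (k - b) * 2 ^ b"
    using assms by (simp flip: power_add)
  then have "(i + 2 ^ k) div 2 ^ b = i div 2 ^ b + 2 ^ (k - b)"
    by simp
  then show ?thesis using assms by (simp add: bsign_def bit_iff_odd)
qed

lemma bsign_add_eq: "i < 2 ^ k \<Longrightarrow> bsign (i + 2 ^ k) k = -1"
  by (simp add: bsign_ge bsign_less)

text \<open>Separates the indices by their top bit; this drives the inductions on
  \<open>k\<close>.\<close>

lemma sum_lessThan_double:
  fixes g :: "nat \<Rightarrow> 'a::comm_monoid_add"
  shows "(\<Sum>i<2 ^ Suc k. g i) = (\<Sum>i<2 ^ k. g i) + (\<Sum>i<2 ^ k. g (i + 2 ^ k))"
proof -
  have "(\<Sum>i<2 ^ Suc k. g i) = (\<Sum>i=0..<2 ^ k. g i) + (\<Sum>i=2 ^ k..<2 ^ k + 2 ^ k. g i)"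
    by (subst sum.atLeastLessThan_concat) (simp_all add: lessThan_atLeast0 mult_2)
  also have "(\<Sum>i=2 ^ k..<2 ^ k + 2 ^ k. g i) = (\<Sum>i=0..<2 ^ k. g (i + 2 ^ k))"
    using sum.shift_bounds_nat_ivl[of g 0 "2 ^ k" "2 ^ k"] by simp
  finally show ?thesis by (simp add: lessThan_atLeast0)
qed

text \<open>Each factor is \<open>-1\<close> if both signs are negative and \<open>1\<close> otherwise.\<close>

definition walsh :: "nat \<Rightarrow> nat \<Rightarrow> nat \<Rightarrow> real" where
  "walsh k i j = (\<Prod>b<k. (1 + bsign i b + bsign j b - bsign i b * bsign j b) / 2)"

text \<open>For \<open>bsign l b = 1\<close> the factor is 1, for \<open>bsign l b = -1\<close> it
  is the sign of the first argument. Both are multiplicative in that argument, so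
  \<open>walsh\<close> is a character in it.\<close>

lemma walsh_xor: "walsh k (i XOR j) l = walsh k i l * walsh k j l"
proof -
  have "(1 + bsign (i XOR j) b + bsign l b - bsign (i XOR j) b * bsign l b) / 2 =
      ((1 + bsign i b + bsign l b - bsign i b * bsign l b) / 2) *
      ((1 + bsign j b + bsign l b - bsign j b * bsign l b) / 2)" for b
    using bsign_cases[of i b] bsign_cases[of j b] bsign_cases[of l b]
    by (auto simp: bsign_xor)
  then show ?thesis unfolding walsh_def prod.distrib[symmetric] by (rule prod.cong[OF refl])
qed

lemma walsh_commute: "walsh k i j = walsh k j i"
  by (simp add: walsh_def algebra_simps)

lemma walsh_0 [simp]: "walsh k i 0 = 1"
  by (simp add: walsh_def)

lemma walsh_square: "walsh k i j * walsh k i j = 1"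
  by (metis walsh_xor walsh_0 walsh_commute xor_self_eq)

lemma walsh_Suc_low: "i < 2 ^ k \<Longrightarrow> walsh (Suc k) i j = walsh k i j"
  by (simp add: walsh_def bsign_less)

lemma walsh_Suc_high: "i < 2 ^ k \<Longrightarrow> walsh (Suc k) (i + 2 ^ k) j = bsign j k * walsh k i j"
  by (simp add: walsh_def bsign_add_eq bsign_add_less)

text \<open>Each bit of \<open>i\<close> is summed out separately: a clear bit contributes 1, a set
  bit the sign of \<open>j\<close>.\<close>

lemma sum_walsh_prod: "(\<Sum>i<2 ^ k. walsh k i j) = (\<Prod>b<k. 1 + bsign j b)"
proof (induction k)
  case 0 then show ?case by (simp add: walsh_def)
next
  case (Suc k)
  have "(\<Sum>i<2 ^ Suc k. walsh (Suc k) i j) =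
      (\<Sum>i<2 ^ k. walsh k i j) + (\<Sum>i<2 ^ k. bsign j k * walsh k i j)"
    unfolding sum_lessThan_double by (simp add: walsh_Suc_low walsh_Suc_high)
  then show ?case using Suc.IH by (simp add: algebra_simps flip: sum_distrib_left)
qed

lemma bit_imp_less_exponent: "j < 2 ^ k \<Longrightarrow> bit j b \<Longrightarrow> b < (k::nat)" for j :: nat
  by (metis bit_take_bit_iff take_bit_nat_eq_self)

text \<open>Orthogonality of characters: a set bit of \<open>j\<close> makes one factor
  \<open>1 + bsign j b\<close> vanish.\<close>

lemma sum_walsh:
  assumes "j < 2 ^ k"
  shows "(\<Sum>i<2 ^ k. walsh k i j) = (if j = 0 then 2 ^ k else 0)"
proof (cases "j = 0")
  case False
  then obtain b where b: "bit j b" using bit_eq_iff[of j 0] by auto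
  with assms have "b < k" by (rule bit_imp_less_exponent)
  with b have "\<exists>b\<in>{..<k}. 1 + bsign j b = 0" by (auto simp: bsign_def)
  then have "(\<Prod>b<k. 1 + bsign j b) = 0" by (simp add: prod_zero)
  with False show ?thesis by (simp add: sum_walsh_prod)
qed simp

lemma xor_less_power: "i < 2 ^ k \<Longrightarrow> j < 2 ^ k \<Longrightarrow> i XOR j < (2::nat) ^ k"
  by (metis take_bit_nat_eq_self_iff take_bit_xor)

lemma sum_xor:
  fixes j :: nat
  assumes "j < 2 ^ k"
  shows "(\<Sum>i<2 ^ k. g (i XOR j)) = (\<Sum>i<2 ^ k. g i)"
proof (rule sum.reindex_bij_betw)
  show "bij_betw (\<lambda>i. i XOR j) {..<2 ^ k} {..<2 ^ k}"
    by (rule bij_betw_byWitness[where f' = "\<lambda>i. i XOR j"])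
      (auto simp: xor_less_power assms xor.assoc)
qed

section \<open>Walsh transform and convolution inverse\<close>

definition walsh_transform :: "nat \<Rightarrow> (nat \<Rightarrow> real) \<Rightarrow> nat \<Rightarrow> real" where
  "walsh_transform k g j = (\<Sum>i<2 ^ k. walsh k i j * g i)"

lemma walsh_transform_0 [simp]: "walsh_transform k g 0 = (\<Sum>i<2 ^ k. g i)"
  by (simp add: walsh_transform_def)

text \<open>Translating \<open>g\<close> multiplies its transform by a character value: write
  \<open>walsh k i l\<close> as \<open>walsh k (i XOR j) l * walsh k j l\<close> and
  reindex.\<close>

lemma sum_xor_walsh:
  assumes "j < 2 ^ k"
  shows "(\<Sum>i<2 ^ k. g (i XOR j) * walsh k i l) = walsh k j l * walsh_transform k g l"
proof -
  have "g (i XOR j) * walsh k i l = walsh k j l * (walsh k (i XOR j) l * g (i XOR j))" for i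
    using walsh_square[of k j l] by (simp add: walsh_xor mult.assoc[symmetric])
  then have "(\<Sum>i<2 ^ k. g (i XOR j) * walsh k i l) =
      walsh k j l * (\<Sum>i<2 ^ k. walsh k (i XOR j) l * g (i XOR j))"
    unfolding sum_distrib_left by (rule sum.cong[OF refl])
  then show ?thesis
    using sum_xor[OF assms, of "\<lambda>i. walsh k i l * g i"]
    by (simp add: walsh_transform_def)
qed

text \<open>Exchanging the sums produces the transform of a translate, whose coefficient cancels
  against its reciprocal. Orthogonality then leaves only \<open>j = 0\<close>; the value
  \<open>2 ^ k\<close> appears because the transform is not normalised.\<close>

lemma sum_xor_inverse_transform:
  assumes "j < 2 ^ k" and "\<And>l. l < 2 ^ k \<Longrightarrow> walsh_transform k g l \<noteq> 0"
  shows "(\<Sum>i<2 ^ k. g (i XOR j) * walsh_transform k (\<lambda>l. 1 / walsh_transform k g l) i) =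
    (if j = 0 then 2 ^ k else 0)"
proof -
  have "(\<Sum>i<2 ^ k. g (i XOR j) * walsh_transform k (\<lambda>l. 1 / walsh_transform k g l) i) =
      (\<Sum>i<2 ^ k. \<Sum>l<2 ^ k. (g (i XOR j) * walsh k i l) / walsh_transform k g l)"
    unfolding walsh_transform_def[of k "\<lambda>l. 1 / walsh_transform k g l"]
    by (simp add: sum_distrib_left mult.assoc walsh_commute)
  also have "\<dots> = (\<Sum>l<2 ^ k. (\<Sum>i<2 ^ k. g (i XOR j) * walsh k i l) / walsh_transform k g l)"
    by (subst sum.swap) (simp add: sum_divide_distrib)
  also have "\<dots> = (\<Sum>l<2 ^ k. walsh k l j)"
    by (rule sum.cong)
      (use assms in \<open>auto simp: sum_xor_walsh walsh_commute[of k j]\<close>)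
  finally show ?thesis using assms(1) by (simp add: sum_walsh)
qed

section \<open>Fourier coefficients of powers of the height\<close>

definition height :: "nat \<Rightarrow> nat \<Rightarrow> real" where
  "height k i = 1 + (\<Sum>b<k. 1 - bsign i b)"

lemma height_ge_1: "height k i \<ge> 1"
  unfolding height_def by (simp add: sum_nonneg bsign_def)

lemma height_Suc_low: "i < 2 ^ k \<Longrightarrow> height (Suc k) i = height k i"
  by (simp add: height_def bsign_less)

lemma height_Suc_high: "i < 2 ^ k \<Longrightarrow> height (Suc k) (i + 2 ^ k) = height k i + 2"
  by (simp add: height_def bsign_add_eq bsign_add_less)

text \<open>
  Splitting off the top bit turns the sum into a sum or a difference of two such sums whose
  arguments differ by 2. The mean value theorem replaces a difference by the derivative, which
  lowers the exponent by 1; the factor \<open>q\<close> does not vanish since \<open>q\<close> is not an integer.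
\<close>

lemma walsh_powr_constant_sign:
  fixes q :: real
  assumes "q \<notin> \<int>"
  shows "(\<forall>u>0. (\<Sum>i<2 ^ k. walsh k i j * (u + (height k i - 1)) powr q) > 0) \<or>
         (\<forall>u>0. (\<Sum>i<2 ^ k. walsh k i j * (u + (height k i - 1)) powr q) < 0)"
  using assms
proof (induction k arbitrary: q)
  case 0 then show ?case by (simp add: walsh_def height_def)
next
  case (Suc k)
  \<comment> \<open>The shift \<open>u\<close> stays free because the top bit moves it by 2;
    \<open>u = 1\<close> gives the height itself. One sign for all \<open>u\<close> allows two
    values to be added and makes the intermediate point of the mean value theorem
    irrelevant.\<close>
  define F where "F k q u = (\<Sum>i<2 ^ k. walsh k i j * (u + (height k i - 1)) powr q)" for k q u
  have step: "F (Suc k) q u = F k q u + bsign j k * F k q (u + 2)" for u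
    unfolding F_def sum_lessThan_double
    by (simp add: walsh_Suc_low walsh_Suc_high height_Suc_low height_Suc_high
        sum_distrib_left algebra_simps)
  have "q \<noteq> 0" using Suc.prems by auto
  have "q - 1 \<notin> \<int>" using Suc.prems by (metis Ints_1 Ints_add diff_add_cancel)
  from Suc.IH[OF this] have IH1: "(\<forall>u>0. F k (q - 1) u > 0) \<or> (\<forall>u>0. F k (q - 1) u < 0)"
    by (simp add: F_def)
  from Suc.IH[OF Suc.prems] have IH0: "(\<forall>u>0. F k q u > 0) \<or> (\<forall>u>0. F k q u < 0)"
    by (simp add: F_def)
  show ?case
  proof (cases "bsign j k = 1")
    case True
    with IH0 show ?thesis unfolding F_def[symmetric] step
      by (fastforce intro!: add_pos_pos add_neg_neg)
  next
    case False
    then have sgn: "bsign j k = -1" using bsign_cases by blast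
    have deriv: "(F k q has_real_derivative q * F k (q - 1) u) (at u)" if "u > 0" for u
    proof -
      have pos: "0 < u + (height k i - 1)" for i using that height_ge_1[of k i] by simp
      have "((\<lambda>u. \<Sum>i<2 ^ k. walsh k i j * (u + (height k i - 1)) powr q) has_real_derivative
          (\<Sum>i<2 ^ k. walsh k i j * (q * (u + (height k i - 1)) powr (q - 1)))) (at u)"
      proof (intro DERIV_sum DERIV_cmult)
        fix i
        have "((\<lambda>u. u + (height k i - 1)) has_real_derivative 1) (at u)"
          by (auto intro!: derivative_eq_intros)
        from DERIV_fun_powr[OF this pos, of q]
        show "((\<lambda>u. (u + (height k i - 1)) powr q) has_real_derivative
            q * (u + (height k i - 1)) powr (q - 1)) (at u)" by simp
      qed
      then show ?thesis unfolding F_def by (simp add: sum_distrib_left mult.left_commute)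
    qed
    \<comment> \<open>Here the step is \<open>F k q u - F k q (u + 2)\<close>; the interval length 2
      and the order of the difference give the factor \<open>- 2 * q\<close>.\<close>
    have mvt: "\<exists>z>0. F (Suc k) q u = - 2 * q * F k (q - 1) z" if "u > 0" for u
    proof -
      have "\<exists>z. u < z \<and> z < u + 2 \<and> F k q (u + 2) - F k q u = (u + 2 - u) * (q * F k (q - 1) z)"
        by (rule MVT2) (use that deriv in auto)
      then obtain z where "u < z" "F k q (u + 2) - F k q u = 2 * (q * F k (q - 1) z)" by auto
      then show ?thesis using that unfolding step sgn by (intro exI[of _ z]) auto
    qed
    have "(\<forall>u>0. F (Suc k) q u > 0) \<or> (\<forall>u>0. F (Suc k) q u < 0)"
    \<comment> \<open>The product \<open>- 2 * q * F k (q - 1) z\<close> is positive exactly when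
      \<open>q\<close> and \<open>F k (q - 1)\<close> have opposite signs.\<close>
    proof (cases "(\<forall>u>0. F k (q - 1) u > 0) \<longleftrightarrow> q < 0")
      case True
      then have "- 2 * q * F k (q - 1) z > 0" if "z > 0" for z
        using IH1 that \<open>q \<noteq> 0\<close> by (auto simp: zero_less_mult_iff mult_less_0_iff not_less)
      then show ?thesis using mvt by metis
    next
      case False
      then have "- 2 * q * F k (q - 1) z < 0" if "z > 0" for z
        using IH1 that \<open>q \<noteq> 0\<close> by (auto simp: zero_less_mult_iff mult_less_0_iff not_less)
      then show ?thesis using mvt by metis
    qed
    then show ?thesis by (simp add: F_def)
  qed
qed

section \<open>Positive weights with constant convolution away from 0\<close>

abbreviation height_transform :: "real \<Rightarrow> nat \<Rightarrow> nat \<Rightarrow> real" where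
  "height_transform p k \<equiv> walsh_transform k (\<lambda>i. height k i powr p)"

lemma height_transform_nonzero:
  assumes "p \<notin> \<int>" shows "height_transform p k j \<noteq> 0"
  using walsh_powr_constant_sign[OF assms, of k j]
  by (auto simp: walsh_transform_def dest!: spec[of _ 1])

definition inverse_weight :: "real \<Rightarrow> nat \<Rightarrow> nat \<Rightarrow> real" where
  "inverse_weight p k = walsh_transform k (\<lambda>l. 1 / height_transform p k l)"

text \<open>Larger than \<open>\<bar>inverse_weight p k i\<bar>\<close> for all \<open>i\<close>, which keeps the weights below positive.\<close>

definition damping :: "real \<Rightarrow> nat \<Rightarrow> real" where
  "damping p k = 1 + (\<Sum>i<2 ^ k. inverse_weight p k i * inverse_weight p k i)"

text \<open>The coefficient at 0 is the plain sum of \<open>height k i powr p\<close>; dividing by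
  it normalises the convolution to 1 away from 0.\<close>

definition weight :: "real \<Rightarrow> nat \<Rightarrow> nat \<Rightarrow> real" where
  "weight p k i = (1 + inverse_weight p k i / damping p k) / height_transform p k 0"

lemma height_transform_0_pos: "height_transform p k 0 > 0"
proof -
  have "height k i powr p > 0" for i using height_ge_1[of k i] by simp
  then show ?thesis by (simp add: sum_pos lessThan_empty_iff)
qed

lemma damping_pos: "damping p k > 0"
  unfolding damping_def by (intro add_pos_nonneg sum_nonneg) auto

lemma weight_pos:
  assumes "i < 2 ^ k" shows "weight p k i > 0"
proof -
  let ?x = "inverse_weight p k i"
  have "?x * ?x \<le> (\<Sum>i<2 ^ k. inverse_weight p k i * inverse_weight p k i)"
    by (rule member_le_sum[of i "{..<2 ^ k}" "\<lambda>i. inverse_weight p k i * inverse_weight p k i"])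
      (use assms in auto)
  \<comment> \<open>From \<open>(x + 1/2)^2 \<ge> 0\<close>.\<close>
  moreover have "- ?x < 1 + ?x * ?x"
    using sum_squares_ge_zero[of "?x + 1/2" 0] by (simp add: algebra_simps)
  ultimately have "- ?x < damping p k" by (simp add: damping_def)
  then have "0 < 1 + ?x / damping p k" using damping_pos[of p k] by (simp add: field_simps)
  then show ?thesis using height_transform_0_pos by (simp add: weight_def)
qed

text \<open>The constant part of the weights gives 1 for every \<open>j\<close>, since XOR with
  \<open>j\<close> permutes the indices. The inverse part gives a positive excess at
  \<open>j = 0\<close> and nothing elsewhere.\<close>

lemma sum_weight:
  assumes "p \<notin> \<int>" "j < 2 ^ k"
  shows "(\<Sum>i<2 ^ k. weight p k i * height k (i XOR j) powr p) =
    1 + (if j = 0 then 2 ^ k / (damping p k * height_transform p k 0) else 0)"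
proof -
  let ?L = "height_transform p k 0" and ?f = "\<lambda>i. height k i powr p"
  have L: "?L = (\<Sum>i<2 ^ k. ?f (i XOR j))" by (simp add: sum_xor[OF assms(2), of ?f])
  have pos: "?L > 0" "damping p k > 0" using height_transform_0_pos damping_pos by auto
  have distr: "(1 + w / d) / l * y = y / l + y * w / (d * l)" for w d l y :: real
    by (simp add: add_divide_distrib distrib_right)
  have "(\<Sum>i<2 ^ k. weight p k i * ?f (i XOR j)) =
      (\<Sum>i<2 ^ k. ?f (i XOR j) / ?L + ?f (i XOR j) * inverse_weight p k i / (damping p k * ?L))"
    by (rule sum.cong[OF refl], unfold weight_def) (rule distr)
  also have "\<dots> = ?L / ?L +
      (\<Sum>i<2 ^ k. ?f (i XOR j) * inverse_weight p k i) / (damping p k * ?L)"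
    unfolding sum.distrib sum_divide_distrib L ..
  also have "(\<Sum>i<2 ^ k. ?f (i XOR j) * inverse_weight p k i) = (if j = 0 then 2 ^ k else 0)"
    unfolding inverse_weight_def
    by (rule sum_xor_inverse_transform) (use assms height_transform_nonzero in auto)
  finally show ?thesis using pos by simp
qed

text \<open>The \<open>p\<close>-th root of the weight, written with the operations of the
  machine.\<close>

definition scale :: "real \<Rightarrow> nat \<Rightarrow> nat \<Rightarrow> real" where
  "scale p k i = exp (ln (weight p k i) / p)"

lemma scale_pos: "scale p k i > 0"
  by (simp add: scale_def)

lemma scale_powr:
  assumes "i < 2 ^ k" "p \<noteq> 0" shows "scale p k i powr p = weight p k i"
  using weight_pos[OF assms(1), of p] assms(2) by (simp add: scale_def powr_def)

section \<open>From weights to the parallelepiped\<close>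

lemma ex_bits:
  "\<exists>j::nat. j < 2 ^ k \<and> (\<forall>b<k. bit j b = P b)"
proof (induction k)
  case (Suc k)
  then obtain j :: nat where j: "j < 2 ^ k" "\<forall>b<k. bit j b = P b" by auto
  show ?case
  proof (cases "P k")
    case True
    have "bit (j + 2 ^ k) b = P b" if "b < Suc k" for b
      using that j True bsign_add_less[of b k j] bsign_add_eq[of j k]
      by (cases "b = k") (auto simp: bsign_def split: if_splits)
    then show ?thesis using j(1) by (intro exI[of _ "j + 2 ^ k"]) auto
  next
    case False
    have "bit j b = P b" if "b < Suc k" for b
      using that j False bsign_less[of j k] by (cases "b = k") (auto simp: bsign_def split: if_splits)
    then show ?thesis using j(1) by (intro exI[of _ j]) auto
  qed
qed simp

text \<open>A small nonzero perturbation leaves \<open>p0\<close> if that is an integer, and reaches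
  no other integer in any case.\<close>

lemma noninteger_perturbation:
  fixes p0 :: real and \<delta> :: "nat \<Rightarrow> real"
  assumes "p0 \<ge> 1" "\<And>n. n > 0 \<Longrightarrow> \<delta> n \<noteq> 0" "\<delta> \<longlonglongrightarrow> 0"
  obtains N where "\<And>n. n > 0 \<Longrightarrow> n \<ge> N \<Longrightarrow> p0 + \<delta> n \<notin> \<int> \<and> p0 + \<delta> n > 0"
proof -
  \<comment> \<open>The distance from \<open>p0\<close> to the nearest integer different from
    \<open>p0\<close>.\<close>
  define d where "d = (if p0 \<in> \<int> then 1 else min (frac p0) (1 - frac p0))"
  have "d > 0" "d \<le> 1" unfolding d_def using frac_lt_1[of p0] frac_ge_0[of p0] frac_eq_0_iff[of p0]
    by (auto simp: min_def)
  have nonint: "p0 + x \<notin> \<int>" if "\<bar>x\<bar> < d" "x \<noteq> 0" for x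
  proof (cases "p0 \<in> \<int>")
    case True
    show ?thesis
    proof
      assume "p0 + x \<in> \<int>"
      then have "x \<in> \<int>" using True by (metis Ints_diff add_diff_cancel_left')
      then show False using that \<open>d \<le> 1\<close> by (auto elim!: Ints_cases)
    qed
  next
    case False
    then have "of_int \<lfloor>p0\<rfloor> < p0 + x" "p0 + x < of_int \<lfloor>p0\<rfloor> + 1"
      using that by (auto simp: d_def frac_def)
    then show ?thesis by (auto elim!: Ints_cases)
  qed
  obtain N where "\<And>n. n \<ge> N \<Longrightarrow> \<bar>\<delta> n\<bar> < d"
    using LIMSEQ_D[OF assms(3) \<open>d > 0\<close>] by auto
  \<comment> \<open>Positivity of the exponent comes from
    \<open>\<bar>\<delta> n\<bar> < d \<le> 1 \<le> p0\<close>.\<close>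
  with nonint assms(1,2) \<open>d \<le> 1\<close> show ?thesis
    by (intro that[of N]) (smt (verit))
qed

lemma isolating_parallelepiped_sign_matrix:
  assumes "p \<notin> \<int>" "p > 0"
  shows "isolating_parallelepiped p k
    (mat (2 ^ k) k (\<lambda>(i, b). - 2 * scale p k i * bsign i b))
    (vec (2 ^ k) (\<lambda>i. scale p k i * height k i))"
    (is "isolating_parallelepiped p k ?V ?t")
proof -
  \<comment> \<open>One formula serves both requirements: \<open>j = 0\<close> belongs to the vector
    \<open>t\<close> itself, every other \<open>j\<close> to a nonzero vertex
    \<open>x\<close>.\<close>
  have powr_sum: "(\<Sum>i<2 ^ k. \<bar>scale p k i * height k (i XOR j)\<bar> powr p) =
      1 + (if j = 0 then 2 ^ k / (damping p k * height_transform p k 0) else 0)"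
    if j: "j < 2 ^ k" for j
  proof -
    have "\<bar>scale p k i * height k (i XOR j)\<bar> powr p = weight p k i * height k (i XOR j) powr p"
      if "i < 2 ^ k" for i
      using scale_pos[of p k i] height_ge_1[of k "i XOR j"] scale_powr[OF that, of p] assms(2)
      by (simp add: abs_mult powr_mult)
    then have "(\<Sum>i<2 ^ k. \<bar>scale p k i * height k (i XOR j)\<bar> powr p) =
        (\<Sum>i<2 ^ k. weight p k i * height k (i XOR j) powr p)"
      by (intro sum.cong) auto
    then show ?thesis using sum_weight[OF assms(1) j] by (rule trans)
  qed
  have "2 ^ k / (damping p k * height_transform p k 0) > 0"
    by (intro divide_pos_pos mult_pos_pos damping_pos height_transform_0_pos) simp
  with powr_sum[of 0] have "1 < (\<Sum>i<2 ^ k. \<bar>scale p k i * height k i\<bar> powr p)"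
    by (simp del: walsh_transform_0)
  then have "1 powr (1 / p) < (\<Sum>i<2 ^ k. \<bar>scale p k i * height k i\<bar> powr p) powr (1 / p)"
    using assms(2) by (intro powr_less_mono2) auto
  then have t: "lp_norm p ?t > 1" by (simp add: lp_norm_def)
  have x: "lp_norm p (?V *\<^sub>v x - ?t) = 1"
    if x: "x \<in> carrier_vec k" "\<forall>b<k. x $ b \<in> {0, 1}" "x \<noteq> 0\<^sub>v k" for x
  proof -
    obtain j :: nat where j: "j < 2 ^ k" "\<forall>b<k. bit j b = (x $ b = 1)" using ex_bits[of k "\<lambda>b. x $ b = 1"] by auto
    have xb: "x $ b = (1 - bsign j b) / 2" if "b < k" for b
      using x(2)[rule_format, OF that] j(2)[rule_format, OF that] by (auto simp: bsign_def)
    have "j \<noteq> 0"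
    proof
      assume "j = 0"
      with xb have "x = 0\<^sub>v k" using x(1) by (intro eq_vecI) auto
      with x(3) show False ..
    qed
    have entry: "(?V *\<^sub>v x - ?t) $ i = - (scale p k i * height k (i XOR j))" if i: "i < 2 ^ k" for i
    proof -
      have "(?V *\<^sub>v x - ?t) $ i =
          (\<Sum>b<k. - 2 * scale p k i * bsign i b * x $ b) - scale p k i * height k i"
        using i x(1) by (simp add: scalar_prod_def lessThan_atLeast0)
      also have "(\<Sum>b<k. - 2 * scale p k i * bsign i b * x $ b) =
          (\<Sum>b<k. - scale p k i * (bsign i b * (1 - bsign j b)))"
        by (rule sum.cong) (auto simp: xb)
      also have "(\<Sum>b<k. - scale p k i * (bsign i b * (1 - bsign j b))) - scale p k i * height k i =
          - scale p k i * (1 + (\<Sum>b<k. bsign i b * (1 - bsign j b) + (1 - bsign i b)))"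
        unfolding height_def sum.distrib sum_distrib_left[symmetric] by (simp add: algebra_simps)
      \<comment> \<open>For signs \<open>s\<close> and \<open>r\<close>,
        \<open>s * (1 - r) + (1 - s) = 1 - s * r\<close>: moving by \<open>x\<close> turns the
        height of \<open>i\<close> into that of \<open>i XOR j\<close>. The factor 2 in the matrix
        has cancelled the half in \<open>x $ b = (1 - bsign j b) / 2\<close>.\<close>
      also have "(\<Sum>b<k. bsign i b * (1 - bsign j b) + (1 - bsign i b)) =
          (\<Sum>b<k. 1 - bsign (i XOR j) b)"
        by (simp add: bsign_xor algebra_simps)
      finally show ?thesis by (simp add: height_def)
    qed
    have "(\<Sum>i<2 ^ k. \<bar>(?V *\<^sub>v x - ?t) $ i\<bar> powr p) = 1"
    proof -
      have "(\<Sum>i<2 ^ k. \<bar>(?V *\<^sub>v x - ?t) $ i\<bar> powr p) =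
          (\<Sum>i<2 ^ k. \<bar>scale p k i * height k (i XOR j)\<bar> powr p)"
        by (rule sum.cong[OF refl]) (simp only: entry lessThan_iff abs_minus_cancel)
      then show ?thesis using powr_sum[OF j(1)] \<open>j \<noteq> 0\<close> by (simp only: if_False add_0_right)
    qed
    then show ?thesis by (simp add: lp_norm_def)
  qed
  show ?thesis
    unfolding isolating_parallelepiped_def using t by (intro conjI ballI impI x) auto
qed

section \<open>Timed execution and change of registers\<close>

text \<open>The time is bounded rather than exact, so that branches of different cost fit one
  statement.\<close>

definition runs :: "real com \<Rightarrow> state \<Rightarrow> nat \<Rightarrow> (state \<Rightarrow> bool) \<Rightarrow> bool" where
  "runs c s B Q \<longleftrightarrow> (\<exists>T s'. exec c s T s' \<and> T \<le> B \<and> Q s')"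

lemma runsI: "exec c s T s' \<Longrightarrow> T \<le> B \<Longrightarrow> Q s' \<Longrightarrow> runs c s B Q"
  unfolding runs_def by blast

lemma runsE:
  assumes "runs c s B Q"
  obtains T s' where "exec c s T s'" "T \<le> B" "Q s'"
  using assms unfolding runs_def by blast

lemma runs_mono:
  assumes "runs c s B Q" "B \<le> B'" "\<And>s. Q s \<Longrightarrow> Q' s"
  shows "runs c s B' Q'"
proof -
  from assms(1) obtain T s' where "exec c s T s'" "T \<le> B" "Q s'" by (rule runsE)
  then show ?thesis by (intro runsI[of c s T s']) (use assms(2,3) in auto)
qed

lemma runs_Assign: "Q ((fst s)(i := nval a s), snd s) \<Longrightarrow> 1 \<le> B \<Longrightarrow> runs (Assign i a) s B Q"
  by (rule runsI[OF exec.Assign])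

lemma runs_Store: "Q (fst s, (snd s)(nval a s := rval r s)) \<Longrightarrow> 1 \<le> B \<Longrightarrow> runs (Store a r) s B Q"
  by (rule runsI[OF exec.Store])

lemma runs_Seq:
  assumes "runs c1 s B1 (\<lambda>s'. runs c2 s' B2 Q)" "B1 + B2 \<le> B"
  shows "runs (Seq c1 c2) s B Q"
proof -
  from assms(1) obtain T1 s1 where 1: "exec c1 s T1 s1" "T1 \<le> B1" "runs c2 s1 B2 Q"
    by (rule runsE)
  from 1(3) obtain T2 s2 where 2: "exec c2 s1 T2 s2" "T2 \<le> B2" "Q s2"
    by (rule runsE)
  show ?thesis by (rule runsI[OF exec.Seq[OF 1(1) 2(1)]]) (use 1 2 assms(2) in auto)
qed

lemma runs_If:
  assumes "bval b s \<Longrightarrow> runs c1 s B Q" "\<not> bval b s \<Longrightarrow> runs c2 s B Q" "B + 1 \<le> B'"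
  shows "runs (If b c1 c2) s B' Q"
proof (cases "bval b s")
  case True
  from assms(1)[OF this] obtain T s' where e: "exec c1 s T s'" "T \<le> B" "Q s'"
    by (rule runsE)
  show ?thesis by (rule runsI[OF exec.IfTrue[OF True e(1)]]) (use e assms(3) in auto)
next
  case False
  from assms(2)[OF this] obtain T s' where e: "exec c2 s T s'" "T \<le> B" "Q s'"
    by (rule runsE)
  show ?thesis by (rule runsI[OF exec.IfFalse[OF False e(1)]]) (use e assms(3) in auto)
qed

definition For :: "nat \<Rightarrow> nexp \<Rightarrow> real com \<Rightarrow> real com" where
  "For i a c = Seq (Assign i (NConst 0))
     (While (NLess (NReg i) a) (Seq c (Assign i (NPlus (NReg i) (NConst 1)))))"

text \<open>A round costs \<open>B\<close> for the body, one step for the increment and one for the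
  test; the final 2 are the initial assignment and the failing test. The limit \<open>a\<close> is
  evaluated anew in each round, so the invariant has to fix its value.\<close>

lemma runs_For:
  assumes init: "I 0 ((fst s)(i := 0), snd s)"
    and bound: "\<And>m s. I m s \<Longrightarrow> fst s i = m \<and> nval a s = n"
    and step: "\<And>m s. m < n \<Longrightarrow> I m s \<Longrightarrow>
      runs c s B (\<lambda>s'. I (Suc m) ((fst s')(i := Suc (fst s' i)), snd s'))"
    and time: "n * (B + 2) + 2 \<le> B'"
    and final: "\<And>s. I n s \<Longrightarrow> Q s"
  shows "runs (For i a c) s B' Q"
proof -
  let ?c = "Seq c (Assign i (NPlus (NReg i) (NConst 1)))"
  \<comment> \<open>Induction on the number \<open>d\<close> of rounds that remain.\<close>
  have loop: "runs (While (NLess (NReg i) a) ?c) s (d * (B + 2) + 1) (I n)"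
    if "I m s" "m + d = n" for d m s
    using that
  proof (induction d arbitrary: m s)
    case 0
    then have "\<not> bval (NLess (NReg i) a) s" using bound by simp
    with 0 show ?case by (intro runsI[OF exec.WhileFalse]) auto
  next
    case (Suc d)
    then have b: "bval (NLess (NReg i) a) s" using bound[of m s] by simp
    have "runs ?c s (B + 1) (I (Suc m))"
    proof (rule runs_Seq)
      show "runs c s B (\<lambda>s'. runs (Assign i (NPlus (NReg i) (NConst 1))) s' 1 (I (Suc m)))"
        by (rule runs_mono[OF step[of m s]]) (use Suc.prems in \<open>auto intro!: runs_Assign\<close>)
    qed simp
    then obtain T1 s1 where 1: "exec ?c s T1 s1" "T1 \<le> B + 1" "I (Suc m) s1"
      by (rule runsE)
    have "runs (While (NLess (NReg i) a) ?c) s1 (d * (B + 2) + 1) (I n)"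
      by (rule Suc.IH[OF 1(3)]) (use Suc.prems(2) in simp)
    then obtain T2 s2 where
      2: "exec (While (NLess (NReg i) a) ?c) s1 T2 s2" "T2 \<le> d * (B + 2) + 1" "I n s2"
      by (rule runsE)
    show ?case
      by (rule runsI[OF exec.WhileTrue[OF b 1(1) 2(1)]]) (use 1(2) 2(2,3) in auto)
  qed
  have "runs (For i a c) s (1 + (n * (B + 2) + 1)) (I n)"
    unfolding For_def
  proof (rule runs_Seq)
    show "runs (Assign i (NConst 0)) s 1 (\<lambda>s'. runs (While (NLess (NReg i) a) ?c) s' (n * (B + 2) + 1) (I n))"
      by (rule runs_Assign) (use loop[OF init] in simp_all)
  qed simp
  then show ?thesis by (rule runs_mono) (use time final in auto)
qed

section \<open>Registers that a program does not mention\<close>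

definition with_regs :: "nat \<Rightarrow> (nat \<Rightarrow> nat) \<Rightarrow> state \<Rightarrow> state" where
  "with_regs R g s = ((\<lambda>i. if i < R then fst s i else g i), snd s)"

primrec nexp_bound :: "nexp \<Rightarrow> nat" where
  "nexp_bound (NConst m) = 0"
| "nexp_bound (NReg i) = Suc i"
| "nexp_bound (NPlus a b) = max (nexp_bound a) (nexp_bound b)"
| "nexp_bound (NMinus a b) = max (nexp_bound a) (nexp_bound b)"

primrec rexp_bound :: "'r rexp \<Rightarrow> nat" where
  "rexp_bound (RConst c) = 0"
| "rexp_bound (ROfNat a) = nexp_bound a"
| "rexp_bound (RLoad a) = nexp_bound a"
| "rexp_bound (RPlus a b) = max (rexp_bound a) (rexp_bound b)"
| "rexp_bound (RMinus a b) = max (rexp_bound a) (rexp_bound b)"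
| "rexp_bound (RTimes a b) = max (rexp_bound a) (rexp_bound b)"
| "rexp_bound (RDivide a b) = max (rexp_bound a) (rexp_bound b)"
| "rexp_bound (RExp a) = rexp_bound a"
| "rexp_bound (RLn a) = rexp_bound a"

primrec bexp_bound :: "'r bexp \<Rightarrow> nat" where
  "bexp_bound (NLess a b) = max (nexp_bound a) (nexp_bound b)"
| "bexp_bound (RLess a b) = max (rexp_bound a) (rexp_bound b)"
| "bexp_bound (BNot b) = bexp_bound b"
| "bexp_bound (BAnd a b) = max (bexp_bound a) (bexp_bound b)"

primrec com_bound :: "'r com \<Rightarrow> nat" where
  "com_bound Skip = 0"
| "com_bound (Assign i a) = max (Suc i) (nexp_bound a)"
| "com_bound (Store a r) = max (nexp_bound a) (rexp_bound r)"
| "com_bound (Seq c1 c2) = max (com_bound c1) (com_bound c2)"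
| "com_bound (If b c1 c2) = max (bexp_bound b) (max (com_bound c1) (com_bound c2))"
| "com_bound (While b c) = max (bexp_bound b) (com_bound c)"

lemma nval_with_regs: "nexp_bound a \<le> R \<Longrightarrow> nval a (with_regs R g s) = nval a s"
  by (induction a) (auto simp: with_regs_def)

lemma rval_with_regs: "rexp_bound a \<le> R \<Longrightarrow> rval a (with_regs R g s) = rval a s"
  by (induction a) (auto simp: nval_with_regs, auto simp: with_regs_def)

lemma bval_with_regs: "bexp_bound b \<le> R \<Longrightarrow> bval b (with_regs R g s) = bval b s"
  by (induction b) (auto simp: nval_with_regs rval_with_regs)

text \<open>Registers from the bound on are neither read nor written, so their contents can be
  exchanged without changing the run. This protects \<open>k\<close> while the program for
  \<open>\<delta>\<close> is running.\<close>

lemma exec_with_regs: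
  "exec c s T s' \<Longrightarrow> com_bound c \<le> R \<Longrightarrow> exec c (with_regs R g s) T (with_regs R g s')"
proof (induction rule: exec.induct)
  case (Assign i a s)
  then have a: "nval a (with_regs R g s) = nval a s" and i: "i < R"
    by (auto intro: nval_with_regs)
  have "with_regs R g ((fst s)(i := nval a s), snd s) =
      ((fst (with_regs R g s))(i := nval a (with_regs R g s)), snd (with_regs R g s))"
    unfolding a using i by (auto simp: with_regs_def)
  then show ?case by (metis exec.Assign)
next
  case (Store a r s)
  then have a: "nval a (with_regs R g s) = nval a s" "rval r (with_regs R g s) = rval r s"
    by (auto intro: nval_with_regs rval_with_regs)
  have "with_regs R g (fst s, (snd s)(nval a s := rval r s)) = (fst (with_regs R g s),
      (snd (with_regs R g s))(nval a (with_regs R g s) := rval r (with_regs R g s)))"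
    unfolding a by (auto simp: with_regs_def)
  then show ?case by (metis exec.Store)
next
  case Seq then show ?case by (auto intro: exec.Seq)
next
  case IfTrue then show ?case by (auto intro!: exec.IfTrue[simplified] simp: bval_with_regs)
next
  case IfFalse then show ?case by (auto intro!: exec.IfFalse[simplified] simp: bval_with_regs)
next
  case WhileFalse then show ?case by (auto intro!: exec.WhileFalse[simplified] simp: bval_with_regs)
next
  case (WhileTrue b s1 c T1 s2 T2 s3)
  then show ?case using exec.WhileTrue[of b "with_regs R g s1" c T1 "with_regs R g s2" T2 "with_regs R g s3"]
    by (simp add: bval_with_regs)
qed (rule exec.Skip)

section \<open>Programs for the sign table, the heights and the transform\<close>

text \<open>The cost of the first command is taken off the budget, and the rest is left for the
  second; the side condition keeps the subtraction from being truncated.\<close>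

lemma runs_Seq_Assign:
  "1 \<le> B \<Longrightarrow> runs c ((fst s)(i := nval a s), snd s) (B - 1) Q \<Longrightarrow> runs (Seq (Assign i a) c) s B Q"
  by (rule runs_Seq[of _ _ 1 _ "B - 1"], rule runs_Assign) auto

lemma runs_Seq_Store:
  "1 \<le> B \<Longrightarrow> runs c (fst s, (snd s)(nval a s := rval r s)) (B - 1) Q \<Longrightarrow>
    runs (Seq (Store a r) c) s B Q"
  by (rule runs_Seq[of _ _ 1 _ "B - 1"], rule runs_Store) auto

lemma runs_Seq_trans:
  "runs c1 s B1 P \<Longrightarrow> B1 \<le> B \<Longrightarrow> (\<And>s'. P s' \<Longrightarrow> runs c2 s' (B - B1) Q) \<Longrightarrow>
    runs (Seq c1 c2) s B Q"
  by (rule runs_Seq[of _ _ B1 _ "B - B1"], erule runs_mono) auto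

lemma index_eq_iff:
  fixes k :: nat
  assumes "b < k" "b' < k"
  shows "i * k + b = i' * k + b' \<longleftrightarrow> i = i' \<and> b = b'"
proof
  assume eq: "i * k + b = i' * k + b'"
  then have "(i * k + b) div k = (i' * k + b') div k" by simp
  then have "i = i'" using assms by simp
  with eq show "i = i' \<and> b = b'" by simp
qed simp

lemma index_less:
  fixes k :: nat
  assumes "i < D" "b < k"
  shows "i * k + b < D * k"
proof -
  have "i * k + b < Suc i * k" using assms(2) by simp
  also have "\<dots> \<le> D * k" using assms(1) by (intro mult_le_mono1) simp
  finally show ?thesis .
qed

text \<open>
  Register 0 holds \<open>k\<close>, register 1 the number \<open>D\<close> of rows, and registers 2 to 5 the addresses of
  the output vector, two work arrays of length \<open>D\<close> and a block of scalars, which holds \<open>p\<close>, a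
  Walsh function value, the Fourier coefficient at 0, the damping constant and a row factor.
  Registers 6 and 8 count rows, 7 counts columns, and 9 and 10 hold the addresses of the rows
  counted by 6 and 8. In \<open>sign_prog\<close>, registers 11 and 12 hold \<open>2 ^ b\<close> and \<open>2 ^ b * k\<close> for the
  current column \<open>b\<close>.
\<close>

definition layout :: "nat \<Rightarrow> nat \<Rightarrow> state \<Rightarrow> bool" where
  "layout k D s \<longleftrightarrow> fst s 0 = k \<and> fst s 1 = D \<and> fst s 2 = D * k \<and> fst s 3 = D * k + D \<and>
     fst s 4 = D * k + 2 * D \<and> fst s 5 = D * k + 3 * D"

definition sign_table :: "nat \<Rightarrow> nat \<Rightarrow> state \<Rightarrow> bool" where
  "sign_table k D s \<longleftrightarrow> (\<forall>i<D. \<forall>b<k. snd s (i * k + b) = bsign i b)"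

abbreviation scalar :: "nat \<Rightarrow> nexp" where
  "scalar c \<equiv> NPlus (NReg 5) (NConst c)"

abbreviation entry :: "nat \<Rightarrow> nat \<Rightarrow> nexp" where
  "entry r i \<equiv> NPlus (NReg r) (NReg i)"

text \<open>Numerals come from natural constants, which \<open>com_reals\<close> does not collect;
  only \<open>p0\<close> is needed as a real constant.\<close>

abbreviation real_const :: "nat \<Rightarrow> 'r rexp" where
  "real_const c \<equiv> ROfNat (NConst c)"

text \<open>Natural numbers cannot be multiplied in one step: \<open>2 ^ k\<close> arises by
  doubling, \<open>2 ^ k * k\<close> by repeated addition. Cell 0 is read before the sign table
  overwrites it; it holds the perturbation to be added to \<open>p0\<close>.\<close>

definition setup_prog :: "real \<Rightarrow> real com" where
  "setup_prog p0 =
     Seq (Assign 1 (NConst 1)) (Seq (For 6 (NReg 0) (Assign 1 (NPlus (NReg 1) (NReg 1))))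
     (Seq (Assign 2 (NConst 0)) (Seq (For 6 (NReg 0) (Assign 2 (NPlus (NReg 2) (NReg 1))))
     (Seq (Assign 3 (NPlus (NReg 2) (NReg 1))) (Seq (Assign 4 (NPlus (NReg 3) (NReg 1)))
     (Seq (Assign 5 (NPlus (NReg 4) (NReg 1)))
       (Store (scalar 0) (RPlus (RConst p0) (RLoad (NConst 0))))))))))"

lemma runs_setup:
  assumes "fst s 0 = k"
  shows "runs (setup_prog p0) s (6 * k + 10)
    (\<lambda>s'. layout k (2 ^ k) s' \<and> snd s' (2 ^ k * k + 3 * 2 ^ k) = p0 + snd s 0)"
proof -
  let ?s1 = "((fst s)(1 := 1), snd s)"
  have loop1: "runs (For 6 (NReg 0) (Assign 1 (NPlus (NReg 1) (NReg 1)))) ?s1 (k * 3 + 2)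
      (\<lambda>t. t = ((fst s)(6 := k, 1 := 2 ^ k), snd s))"
    by (rule runs_For[where I = "\<lambda>m t. t = ((fst s)(6 := m, 1 := 2 ^ m), snd s)"
          and n = k and B = 1])
      (use assms in \<open>auto intro!: runs_Assign simp: fun_eq_iff\<close>)
  have loop2: "runs (For 6 (NReg 0) (Assign 2 (NPlus (NReg 2) (NReg 1))))
      ((fst s)(6 := k, 1 := 2 ^ k, 2 := 0), snd s) (k * 3 + 2)
      (\<lambda>t. t = ((fst s)(6 := k, 1 := 2 ^ k, 2 := 2 ^ k * k), snd s))"
    by (rule runs_For[where I = "\<lambda>m t. t = ((fst s)(6 := m, 1 := 2 ^ k, 2 := 2 ^ k * m), snd s)"
          and n = k and B = 1])
      (use assms in \<open>auto intro!: runs_Assign simp: fun_eq_iff\<close>)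
  show ?thesis
    unfolding setup_prog_def
    apply (rule runs_Seq_Assign, simp, simp)
    apply (rule runs_Seq_trans[OF loop1[simplified]], simp, simp)
    apply (rule runs_Seq_Assign, simp, simp)
    apply (rule runs_Seq_trans[OF loop2[simplified]], simp, simp)
    apply (rule runs_Seq_Assign runs_Store | simp add: layout_def assms)+
    done
qed

section \<open>The sign table\<close>

text \<open>The recurrence \<open>bsign_ge\<close>: register 12 is the distance in memory between
  rows \<open>i\<close> and \<open>i - 2 ^ b\<close>.\<close>

definition sign_entry :: "real com" where
  "sign_entry = If (NLess (NReg 6) (NReg 11))
     (Store (entry 9 7) (real_const 1))
     (Store (entry 9 7) (RMinus (real_const 0) (RLoad (NMinus (entry 9 7) (NReg 12)))))"

definition sign_column :: "real com" where
  "sign_column = For 6 (NReg 1) (Seq sign_entry (Assign 9 (NPlus (NReg 9) (NReg 0))))"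

definition sign_prog :: "real com" where
  "sign_prog =
     Seq (Assign 11 (NConst 1)) (Seq (Assign 12 (NReg 0))
       (For 7 (NReg 0)
         (Seq (Assign 9 (NConst 0)) (Seq sign_column
           (Seq (Assign 11 (NPlus (NReg 11) (NReg 11)))
             (Assign 12 (NPlus (NReg 12) (NReg 12))))))))"

lemma runs_sign:
  assumes "layout k D s"
  shows "runs sign_prog s (k * (D * 5 + 7) + 4)
    (\<lambda>s'. layout k D s' \<and> sign_table k D s' \<and> (\<forall>a\<ge>D * k. snd s' a = snd s a))"
proof -
  \<comment> \<open>Columns before \<open>b\<close> are complete and column \<open>b\<close> is
    filled in the rows before \<open>m\<close>. A complete column, \<open>m = D\<close>, is the
    start \<open>m = 0\<close> of the next one.\<close>
  define I where "I m b t \<longleftrightarrow> layout k D t \<and> fst t 7 = b \<and> fst t 11 = 2 ^ b \<and>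
      fst t 12 = 2 ^ b * k \<and> (\<forall>a\<ge>D * k. snd t a = snd s a) \<and>
      (\<forall>i<D. \<forall>c<k. c < b \<or> c = b \<and> i < m \<longrightarrow> snd t (i * k + c) = bsign i c)"
    for m b :: nat and t :: state
  have column: "runs sign_column t (D * 5 + 2) (I D b)"
    if "b < k" "I 0 b t" "fst t 9 = 0" for b t
    unfolding sign_column_def
  proof (rule runs_For[where I = "\<lambda>i t. I i b t \<and> fst t 6 = i \<and> fst t 9 = i * k" and n = D and B = 3])
    show "I 0 b ((fst t)(6 := 0), snd t) \<and> fst ((fst t)(6 := 0), snd t) 6 = 0 \<and>
        fst ((fst t)(6 := 0), snd t) 9 = 0 * k"
      using that(2,3) by (simp add: I_def layout_def)
    fix i u
    assume u: "I i b u \<and> fst u 6 = i \<and> fst u 9 = i * k"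
    then show "fst u 6 = i \<and> nval (NReg 1) u = D" by (simp add: I_def layout_def)
    assume "i < D"
    have upd: "I (Suc i) b ((fst u)(9 := x, 6 := y), (snd u)(i * k + b := bsign i b))" for x y
      using u that(1) index_less[OF \<open>i < D\<close> that(1)]
      by (auto simp: I_def layout_def index_eq_iff[OF _ that(1)] less_Suc_eq)
    \<comment> \<open>The row \<open>2 ^ b\<close> higher up has a smaller index, so its entry is
      already correct.\<close>
    have old: "snd u (i * k + b - 2 ^ b * k) = bsign (i - 2 ^ b) b" if "\<not> i < 2 ^ b"
    proof -
      have "i * k + b - 2 ^ b * k = (i - 2 ^ b) * k + b"
        using that by (simp add: diff_mult_distrib mult_le_mono1)
      moreover have "0 < i" using that by (cases "i = 0") auto
      then have "i - 2 ^ b < i" by simp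
      ultimately show ?thesis using u \<open>b < k\<close> \<open>i < D\<close> by (simp add: I_def)
    qed
    have regs: "fst u 7 = b" "fst u 11 = 2 ^ b" "fst u 12 = 2 ^ b * k" "fst u 9 = i * k"
      "fst u 6 = i" "fst u 0 = k"
      using u by (auto simp: I_def layout_def)
    have "runs sign_entry u 2 (\<lambda>t. t = (fst u, (snd u)(i * k + b := bsign i b)))"
      unfolding sign_entry_def
      by (rule runs_If[where B = 1]; (rule runs_Store)?)
        (simp_all add: regs old bsign_less bsign_ge)
    then show "runs (Seq sign_entry (Assign 9 (NPlus (NReg 9) (NReg 0)))) u 3
       (\<lambda>s'. I (Suc i) b ((fst s')(6 := Suc (fst s' 6)), snd s') \<and>
          fst ((fst s')(6 := Suc (fst s' 6)), snd s') 6 = Suc i \<and>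
          fst ((fst s')(6 := Suc (fst s' 6)), snd s') 9 = Suc i * k)"
      by (rule runs_Seq_trans) (use upd regs in \<open>auto intro!: runs_Assign\<close>)
  qed auto
  show ?thesis
    unfolding sign_prog_def
  proof (intro runs_Seq_Assign)
    show "runs (For 7 (NReg 0)
         (Seq (Assign 9 (NConst 0)) (Seq sign_column
           (Seq (Assign 11 (NPlus (NReg 11) (NReg 11)))
             (Assign 12 (NPlus (NReg 12) (NReg 12)))))))
        ((fst ((fst s)(11 := nval (NConst 1) s), snd s))
           (12 := nval (NReg 0) ((fst s)(11 := nval (NConst 1) s), snd s)),
         snd ((fst s)(11 := nval (NConst 1) s), snd s))
        (k * (D * 5 + 7) + 4 - 1 - 1)
        (\<lambda>s'. layout k D s' \<and> sign_table k D s' \<and> (\<forall>a\<ge>D * k. snd s' a = snd s a))"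
    proof (rule runs_For[where I = "I 0" and n = k and B = "D * 5 + 5"])
      fix b t
      assume t: "I 0 b t"
      then show "fst t 7 = b \<and> nval (NReg 0) t = k" by (simp add: I_def layout_def)
      assume "b < k"
      show "runs (Seq (Assign 9 (NConst 0)) (Seq sign_column
           (Seq (Assign 11 (NPlus (NReg 11) (NReg 11)))
             (Assign 12 (NPlus (NReg 12) (NReg 12)))))) t (D * 5 + 5)
          (\<lambda>s'. I 0 (Suc b) ((fst s')(7 := Suc (fst s' 7)), snd s'))"
      proof (rule runs_Seq_Assign, simp, rule runs_Seq_trans[OF column[OF \<open>b < k\<close>]])
        fix u
        assume "I D b u"
        then have "I 0 (Suc b) ((fst u)(11 := 2 ^ Suc b, 12 := 2 ^ Suc b * k, 7 := Suc b), snd u)"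
          by (auto simp: I_def layout_def less_Suc_eq)
        moreover have "fst u 7 = b" "fst u 11 = 2 ^ b" "fst u 12 = 2 ^ b * k"
          using \<open>I D b u\<close> by (auto simp: I_def)
        ultimately show "runs (Seq (Assign 11 (NPlus (NReg 11) (NReg 11)))
             (Assign 12 (NPlus (NReg 12) (NReg 12)))) u (D * 5 + 5 - 1 - (D * 5 + 2))
            (\<lambda>s'. I 0 (Suc b) ((fst s')(7 := Suc (fst s' 7)), snd s'))"
          by (intro runs_Seq_Assign runs_Assign) (simp_all add: mult.assoc flip: mult_2)
      qed (use t in \<open>auto simp: I_def layout_def\<close>)
    qed (use assms in \<open>auto simp: I_def layout_def sign_table_def\<close>)
  qed simp_all
qed

section \<open>Heights and their powers\<close>

definition height_row :: "real com" where
  "height_row = For 7 (NReg 0) (Store (entry 2 6)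
     (RPlus (RLoad (entry 2 6)) (RMinus (real_const 1) (RLoad (entry 9 7)))))"

text \<open>Each sum starts with an explicit store, since memory may hold leftovers of an earlier
  program.\<close>

definition height_prog :: "real com" where
  "height_prog = Seq (Assign 9 (NConst 0)) (For 6 (NReg 1)
     (Seq (Store (entry 2 6) (real_const 1)) (Seq height_row
       (Seq (Store (entry 3 6) (RExp (RTimes (RLoad (scalar 0)) (RLn (RLoad (entry 2 6))))))
         (Assign 9 (NPlus (NReg 9) (NReg 0)))))))"

lemma runs_height_row:
  assumes "layout k D t" "sign_table k D t" "i < D" "fst t 6 = i" "fst t 9 = i * k"
    "snd t (D * k + i) = 1"
  shows "runs height_row t (k * 3 + 2)
    (\<lambda>u. u = ((fst t)(7 := k), (snd t)(D * k + i := height k i)))"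
  unfolding height_row_def
proof (rule runs_For[where n = k and B = 1 and I = "\<lambda>b u. u = ((fst t)(7 := b),
      (snd t)(D * k + i := height b i))"])
  fix b u
  assume u: "u = ((fst t)(7 := b), (snd t)(D * k + i := height b i))"
  then show "fst u 7 = b \<and> nval (NReg 0) u = k" using assms(1) by (simp add: layout_def)
  assume "b < k"
  with assms(3) have "i * k + b < D * k" by (rule index_less)
  moreover have "snd t (i * k + b) = bsign i b"
    using assms(2,3) \<open>b < k\<close> by (simp add: sign_table_def)
  ultimately show "runs (Store (entry 2 6)
     (RPlus (RLoad (entry 2 6)) (RMinus (real_const 1) (RLoad (entry 9 7))))) u 1
       (\<lambda>s'. ((fst s')(7 := Suc (fst s' 7)), snd s') =
         ((fst t)(7 := Suc b), (snd t)(D * k + i := height (Suc b) i)))"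
    using assms by (intro runs_Store) (auto simp: u layout_def height_def)
qed (use assms(6) in \<open>auto simp: height_def\<close>)

lemma runs_height:
  assumes "layout k D s" "sign_table k D s" "snd s (D * k + 3 * D) = p"
  shows "runs height_prog s (D * (k * 3 + 7) + 3)
    (\<lambda>s'. layout k D s' \<and> sign_table k D s' \<and> snd s' (D * k + 3 * D) = p \<and>
      (\<forall>i<D. snd s' (D * k + i) = height k i \<and> snd s' (D * k + D + i) = height k i powr p))"
proof -
  define I where "I i t \<longleftrightarrow> layout k D t \<and> sign_table k D t \<and> snd t (D * k + 3 * D) = p \<and>
      fst t 6 = i \<and> fst t 9 = i * k \<and>
      (\<forall>j<i. snd t (D * k + j) = height k j \<and> snd t (D * k + D + j) = height k j powr p)"
    for i :: nat and t :: state
  show ?thesis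
    unfolding height_prog_def
  proof (rule runs_Seq_Assign, simp, rule runs_For[where I = I and n = D and B = "k * 3 + 5"])
    fix i t
    assume t: "I i t"
    then show "fst t 6 = i \<and> nval (NReg 1) t = D" by (simp add: I_def layout_def)
    assume "i < D"
    have table: "sign_table k D (f, (snd t)(D * k + a := x))" for f a x
      using t by (auto simp: I_def sign_table_def dest: index_less[of _ D _ k])
    have table': "sign_table k D (f, (snd t)(D * k + a := x, D * k + c := y))" for f a c x y
      using t by (auto simp: I_def sign_table_def dest: index_less[of _ D _ k])
    \<comment> \<open>Positivity identifies \<open>exp (p * ln h)\<close> with
      \<open>h powr p\<close> and makes \<open>RLn\<close> the ordinary logarithm.\<close>
    have pos: "height k i > 0" using height_ge_1[of k i] by simp
    let ?t1 = "(fst t, (snd t)(D * k + i := 1))"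
    have row: "runs height_row ?t1 (k * 3 + 2)
        (\<lambda>u. u = ((fst t)(7 := k), (snd t)(D * k + i := height k i)))"
      using runs_height_row[of k D ?t1 i] t \<open>i < D\<close> table by (simp add: I_def layout_def)
    have regs: "fst t 0 = k" "fst t 2 = D * k" "fst t 3 = D * k + D" "fst t 5 = D * k + 3 * D"
        "fst t 6 = i" "fst t 9 = i * k" "snd t (D * k + 3 * D) = p"
      using t by (auto simp: I_def layout_def)
    have upd: "I (Suc i) ((fst t)(7 := k, 9 := i * k + k, 6 := Suc i),
        (snd t)(D * k + i := height k i, D * k + (D + i) := height k i powr p))"
      using t \<open>i < D\<close> table'
      by (auto simp: I_def layout_def less_Suc_eq)
    show "runs (Seq (Store (entry 2 6) (real_const 1)) (Seq height_row
       (Seq (Store (entry 3 6) (RExp (RTimes (RLoad (scalar 0)) (RLn (RLoad (entry 2 6))))))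
         (Assign 9 (NPlus (NReg 9) (NReg 0)))))) t (k * 3 + 5)
       (\<lambda>s'. I (Suc i) ((fst s')(6 := Suc (fst s' 6)), snd s'))"
    proof (rule runs_Seq_Store, simp, rule runs_Seq_trans[where ?B1.0 = "k * 3 + 2"])
      show "runs height_row (fst t, (snd t)(nval (entry 2 6) t := rval (real_const 1) t)) (k * 3 + 2)
          (\<lambda>u. u = ((fst t)(7 := k), (snd t)(D * k + i := height k i)))"
        using row by (simp add: regs)
      fix u
      assume u: "u = ((fst t)(7 := k), (snd t)(D * k + i := height k i))"
      show "runs (Seq (Store (entry 3 6) (RExp (RTimes (RLoad (scalar 0)) (RLn (RLoad (entry 2 6))))))
         (Assign 9 (NPlus (NReg 9) (NReg 0)))) u (k * 3 + 5 - 1 - (k * 3 + 2))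
         (\<lambda>s'. I (Suc i) ((fst s')(6 := Suc (fst s' 6)), snd s'))"
        using upd pos \<open>i < D\<close>
        by (intro runs_Seq_Store runs_Assign) (simp_all add: u regs powr_def add.assoc)
    qed simp
  qed (use assms in \<open>auto simp: I_def layout_def sign_table_def\<close>)
qed

section \<open>The Walsh transform as a program\<close>

text \<open>The arithmetic form of a factor of \<open>walsh\<close> is evaluated directly on two
  rows of the sign table, without branching.\<close>

definition walsh_prog :: "real com" where
  "walsh_prog = For 7 (NReg 0) (Store (scalar 1) (RTimes (RLoad (scalar 1))
     (RDivide (RMinus
         (RPlus (RPlus (real_const 1) (RLoad (entry 9 7))) (RLoad (entry 10 7)))
         (RTimes (RLoad (entry 9 7)) (RLoad (entry 10 7))))
       (real_const 2))))"

definition transform_row :: "real com" where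
  "transform_row = For 6 (NReg 1) (Seq (Store (scalar 1) (real_const 1)) (Seq walsh_prog
     (Seq (Store (entry 4 8) (RPlus (RLoad (entry 4 8))
         (RTimes (RLoad (scalar 1)) (RLoad (entry 3 6)))))
       (Assign 9 (NPlus (NReg 9) (NReg 0))))))"

text \<open>It serves twice, on \<open>height powr p\<close> and later on the reciprocal
  coefficients; both times the input lies at register 3 and the output at register 4.\<close>

definition transform_prog :: "real com" where
  "transform_prog = Seq (Assign 10 (NConst 0)) (For 8 (NReg 1)
     (Seq (Store (entry 4 8) (real_const 0)) (Seq (Assign 9 (NConst 0)) (Seq transform_row
       (Assign 10 (NPlus (NReg 10) (NReg 0)))))))"

lemma runs_walsh:
  assumes "layout k D t" "sign_table k D t" "i < D" "j < D" "fst t 9 = i * k" "fst t 10 = j * k"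
    "snd t (D * k + 3 * D + 1) = 1"
  shows "runs walsh_prog t (k * 3 + 2)
    (\<lambda>u. u = ((fst t)(7 := k), (snd t)(D * k + 3 * D + 1 := walsh k i j)))"
  unfolding walsh_prog_def
proof (rule runs_For[where n = k and B = 1 and I = "\<lambda>b u. u = ((fst t)(7 := b),
      (snd t)(D * k + 3 * D + 1 := walsh b i j))"])
  fix b u
  assume u: "u = ((fst t)(7 := b), (snd t)(D * k + 3 * D + 1 := walsh b i j))"
  then show "fst u 7 = b \<and> nval (NReg 0) u = k" using assms(1) by (simp add: layout_def)
  assume "b < k"
  then have less: "i * k + b < D * k" "j * k + b < D * k" using assms(3,4) by (auto intro: index_less)
  have "snd t (i * k + b) = bsign i b" "snd t (j * k + b) = bsign j b"
    using assms(2-4) \<open>b < k\<close> by (auto simp: sign_table_def)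
  with less show "runs (Store (scalar 1) (RTimes (RLoad (scalar 1))
     (RDivide (RMinus
         (RPlus (RPlus (real_const 1) (RLoad (entry 9 7))) (RLoad (entry 10 7)))
         (RTimes (RLoad (entry 9 7)) (RLoad (entry 10 7))))
       (real_const 2)))) u 1
       (\<lambda>s'. ((fst s')(7 := Suc (fst s' 7)), snd s') =
         ((fst t)(7 := Suc b), (snd t)(D * k + 3 * D + 1 := walsh (Suc b) i j)))"
    using assms by (intro runs_Store) (auto simp: u layout_def walsh_def)
qed (use assms(7) in \<open>auto simp: walsh_def\<close>)

lemma sign_table_upd:
  assumes "sign_table k D (f, m)" shows "sign_table k D (f', m(D * k + a := x))"
  using assms by (auto simp: sign_table_def dest: index_less[of _ D _ k])

text \<open>A frame condition on memory alone. It is mostly used with \<open>A\<close> the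
  complement of the cells that a program may write.\<close>

definition agree_on :: "nat set \<Rightarrow> state \<Rightarrow> state \<Rightarrow> bool" where
  "agree_on A s t \<longleftrightarrow> (\<forall>a\<in>A. snd t a = snd s a)"

lemma agree_onD: "agree_on A s t \<Longrightarrow> a \<in> A \<Longrightarrow> snd t a = snd s a"
  by (simp add: agree_on_def)

lemma agree_on_refl: "snd t = snd s \<Longrightarrow> agree_on A s t"
  by (simp add: agree_on_def)

lemma agree_on_upd: "agree_on A s t \<Longrightarrow> a \<notin> A \<Longrightarrow> agree_on A s (f, (snd t)(a := x))"
  by (auto simp: agree_on_def)

lemma agree_on_trans: "agree_on A s t \<Longrightarrow> agree_on A t u \<Longrightarrow> agree_on A s u"
  by (simp add: agree_on_def)

lemma agree_on_regs: "agree_on A s t \<Longrightarrow> agree_on A s (f, snd t)"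
  by (simp add: agree_on_def)

lemma agree_on_subset: "agree_on A s t \<Longrightarrow> B \<subseteq> A \<Longrightarrow> agree_on B s t"
  by (auto simp: agree_on_def)

lemma sign_table_agree:
  assumes "sign_table k D s" "agree_on A s t" "{..<D * k} \<subseteq> A"
  shows "sign_table k D t"
  unfolding sign_table_def
proof (intro allI impI)
  fix i b
  assume "i < D" "b < k"
  moreover from this have "i * k + b \<in> A" using index_less assms(3) by blast
  ultimately show "snd t (i * k + b) = bsign i b"
    using assms(1) agree_onD[OF assms(2)] by (simp add: sign_table_def)
qed

lemma runs_transform_row:
  assumes "layout k D s" "sign_table k D s" "\<forall>i<D. snd s (D * k + D + i) = g i" "j < D"
    "fst s 8 = j" "fst s 10 = j * k" "fst s 9 = 0" "snd s (D * k + 2 * D + j) = 0"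
  shows "runs transform_row s (D * (k * 3 + 7) + 2)
    (\<lambda>t. layout k D t \<and> fst t 8 = j \<and> fst t 10 = j * k \<and>
      snd t (D * k + 2 * D + j) = (\<Sum>i<D. walsh k i j * g i) \<and>
      agree_on (- {D * k + 2 * D + j, D * k + 3 * D + 1}) s t)"
proof -
  \<comment> \<open>In \<open>\<Sum>i<i.\<close> the limit is the row counter outside, while the
    summation index is bound.\<close>
  define I where "I i t \<longleftrightarrow> layout k D t \<and> sign_table k D t \<and>
      fst t 8 = j \<and> fst t 10 = j * k \<and> fst t 6 = i \<and> fst t 9 = i * k \<and>
      snd t (D * k + 2 * D + j) = (\<Sum>i<i. walsh k i j * g i) \<and>
      (\<forall>a. a \<noteq> D * k + 2 * D + j \<and> a \<noteq> D * k + 3 * D + 1 \<longrightarrow> snd t a = snd s a)"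
    for i :: nat and t :: state
  show ?thesis
    unfolding transform_row_def
  proof (rule runs_For[where I = I and n = D and B = "k * 3 + 5"])
    fix i t
    assume t: "I i t"
    then show "fst t 6 = i \<and> nval (NReg 1) t = D" by (simp add: I_def layout_def)
    assume "i < D"
    let ?t1 = "(fst t, (snd t)(D * k + 3 * D + 1 := 1))"
    have "sign_table k D (fst t, snd t)" using t by (simp add: I_def)
    note table = sign_table_upd[OF this] sign_table_upd[OF sign_table_upd[OF this]]
    have row: "runs walsh_prog ?t1 (k * 3 + 2)
        (\<lambda>u. u = ((fst t)(7 := k), (snd t)(D * k + 3 * D + 1 := walsh k i j)))"
      using runs_walsh[of k D ?t1 i j] t \<open>i < D\<close> \<open>j < D\<close> table(1)[of _ "3 * D + 1"]
      by (simp add: I_def layout_def add.assoc)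
    have "snd t (D * k + D + i) = g i"
      using t assms(3) \<open>i < D\<close> by (simp add: I_def)
    then have regs: "fst t 0 = k" "fst t 4 = D * k + 2 * D" "fst t 3 = D * k + D"
        "fst t 5 = D * k + 3 * D" "fst t 6 = i" "fst t 9 = i * k" "fst t 8 = j"
        "snd t (D * k + D + i) = g i"
        "snd t (D * k + 2 * D + j) = (\<Sum>i<i. walsh k i j * g i)"
      using t by (auto simp: I_def layout_def)
    have upd: "I (Suc i) ((fst t)(7 := k, 9 := i * k + k, 6 := Suc i),
        (snd t)(D * k + 3 * D + 1 := x, D * k + 2 * D + j := (\<Sum>i<Suc i. walsh k i j * g i)))" for x
      using t \<open>j < D\<close> table(2)[of _ "3 * D + 1" _ "2 * D + j"]
      by (auto simp: I_def layout_def add.assoc)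
    show "runs (Seq (Store (scalar 1) (real_const 1)) (Seq walsh_prog
     (Seq (Store (entry 4 8) (RPlus (RLoad (entry 4 8))
         (RTimes (RLoad (scalar 1)) (RLoad (entry 3 6)))))
       (Assign 9 (NPlus (NReg 9) (NReg 0)))))) t (k * 3 + 5)
       (\<lambda>s'. I (Suc i) ((fst s')(6 := Suc (fst s' 6)), snd s'))"
    proof (rule runs_Seq_Store, simp, rule runs_Seq_trans[where ?B1.0 = "k * 3 + 2"])
      show "runs walsh_prog (fst t, (snd t)(nval (scalar 1) t := rval (real_const 1) t)) (k * 3 + 2)
          (\<lambda>u. u = ((fst t)(7 := k), (snd t)(D * k + 3 * D + 1 := walsh k i j)))"
        using row by (simp add: regs)
      fix u
      assume u: "u = ((fst t)(7 := k), (snd t)(D * k + 3 * D + 1 := walsh k i j))"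
      show "runs (Seq (Store (entry 4 8) (RPlus (RLoad (entry 4 8))
         (RTimes (RLoad (scalar 1)) (RLoad (entry 3 6)))))
       (Assign 9 (NPlus (NReg 9) (NReg 0)))) u (k * 3 + 5 - 1 - (k * 3 + 2))
         (\<lambda>s'. I (Suc i) ((fst s')(6 := Suc (fst s' 6)), snd s'))"
        using upd \<open>i < D\<close> \<open>j < D\<close>
        by (intro runs_Seq_Store runs_Assign) (simp_all add: u regs)
    qed simp
  qed (use assms in \<open>auto simp: I_def layout_def sign_table_def agree_on_def\<close>)
qed

lemma runs_transform:
  assumes "layout k D s" "sign_table k D s" "\<forall>i<D. snd s (D * k + D + i) = g i"
  shows "runs transform_prog s (D * (D * (k * 3 + 7) + 7) + 3)
    (\<lambda>t. layout k D t \<and> (\<forall>j<D. snd t (D * k + 2 * D + j) = (\<Sum>i<D. walsh k i j * g i)) \<and>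
      agree_on (- ({D * k + 2 * D..<D * k + 3 * D} \<union> {D * k + 3 * D + 1})) s t)"
proof -
  define A where "A = - ({D * k + 2 * D..<D * k + 3 * D} \<union> {D * k + 3 * D + 1})"
  define I where "I j t \<longleftrightarrow> layout k D t \<and> fst t 8 = j \<and> fst t 10 = j * k \<and>
      (\<forall>l<j. snd t (D * k + 2 * D + l) = (\<Sum>i<D. walsh k i l * g i)) \<and> agree_on A s t"
    for j :: nat and t :: state
  have table_A: "{..<D * k} \<subseteq> A" and data_A: "D * k + D + i \<in> A" if "i < D" for i
    using that by (auto simp: A_def)
  show ?thesis
    unfolding transform_prog_def A_def[symmetric]
  proof (rule runs_Seq_Assign, simp, rule runs_For[where I = I and n = D and B = "D * (k * 3 + 7) + 5"])
    fix j t
    assume t: "I j t"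
    then show "fst t 8 = j \<and> nval (NReg 1) t = D" by (simp add: I_def layout_def)
    assume "j < D"
    let ?t1 = "((fst t)(9 := 0), (snd t)(D * k + 2 * D + j := 0))"
    have regs: "fst t 4 = D * k + 2 * D" "fst t 8 = j"
      using t by (auto simp: I_def layout_def)
    have agree: "agree_on A s ?t1"
      using t \<open>j < D\<close> by (intro agree_on_upd) (auto simp: I_def A_def)
    have tab: "sign_table k D ?t1"
      using assms(2) agree table_A[OF \<open>j < D\<close>] by (rule sign_table_agree)
    have data: "\<forall>i<D. snd ?t1 (D * k + D + i) = g i"
      using agree_onD[OF agree] data_A assms(3) by metis
    have lay: "layout k D ?t1" "fst ?t1 8 = j" "fst ?t1 10 = j * k" "fst ?t1 9 = 0"
        "snd ?t1 (D * k + 2 * D + j) = 0"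
      using t by (auto simp: I_def layout_def)
    show "runs (Seq (Store (entry 4 8) (real_const 0)) (Seq (Assign 9 (NConst 0)) (Seq transform_row
       (Assign 10 (NPlus (NReg 10) (NReg 0)))))) t (D * (k * 3 + 7) + 5)
       (\<lambda>s'. I (Suc j) ((fst s')(8 := Suc (fst s' 8)), snd s'))"
    proof (rule runs_Seq_Store, simp, rule runs_Seq_Assign, simp, rule runs_Seq_trans)
      have start: "((fst (fst t, (snd t)(nval (entry 4 8) t := rval (real_const 0) t)))
            (9 := nval (NConst 0) (fst t, (snd t)(nval (entry 4 8) t := rval (real_const 0) t))),
           snd (fst t, (snd t)(nval (entry 4 8) t := rval (real_const 0) t))) = ?t1"
        by (simp only: regs nval.simps rval.simps fst_conv snd_conv of_nat_0)
      show "runs transform_row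
          ((fst (fst t, (snd t)(nval (entry 4 8) t := rval (real_const 0) t)))
            (9 := nval (NConst 0) (fst t, (snd t)(nval (entry 4 8) t := rval (real_const 0) t))),
           snd (fst t, (snd t)(nval (entry 4 8) t := rval (real_const 0) t)))
          (D * (k * 3 + 7) + 2)
        (\<lambda>t. layout k D t \<and> fst t 8 = j \<and> fst t 10 = j * k \<and>
          snd t (D * k + 2 * D + j) = (\<Sum>i<D. walsh k i j * g i) \<and>
          agree_on (- {D * k + 2 * D + j, D * k + 3 * D + 1}) ?t1 t)"
        unfolding start
        using runs_transform_row[OF lay(1) tab data \<open>j < D\<close> lay(2-5)] .
      fix u
      assume u: "layout k D u \<and> fst u 8 = j \<and> fst u 10 = j * k \<and>
          snd u (D * k + 2 * D + j) = (\<Sum>i<D. walsh k i j * g i) \<and>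
          agree_on (- {D * k + 2 * D + j, D * k + 3 * D + 1}) ?t1 u"
      have "A \<subseteq> - {D * k + 2 * D + j, D * k + 3 * D + 1}"
        using \<open>j < D\<close> by (auto simp: A_def)
      with u have "agree_on A ?t1 u" by (blast intro: agree_on_subset)
      with agree have "agree_on A s u" by (rule agree_on_trans)
      \<comment> \<open>Coefficients found earlier survive: a row writes only its own cell and the
        cell for the Walsh value.\<close>
      moreover have "snd u (D * k + 2 * D + l) = snd t (D * k + 2 * D + l)" if "l < j" for l
        using agree_onD[of "- {D * k + 2 * D + j, D * k + 3 * D + 1}" ?t1 u "D * k + 2 * D + l"]
          u that \<open>j < D\<close> by simp
      ultimately have "I (Suc j) ((fst u)(10 := j * k + k, 8 := Suc j), snd u)"
        using u t by (auto simp: I_def layout_def less_Suc_eq intro: agree_on_regs)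
      then show "runs (Assign 10 (NPlus (NReg 10) (NReg 0))) u
          (D * (k * 3 + 7) + 5 - 1 - 1 - (D * (k * 3 + 7) + 2))
         (\<lambda>s'. I (Suc j) ((fst s')(8 := Suc (fst s' 8)), snd s'))"
        using u by (intro runs_Assign) (simp_all add: layout_def)
    qed simp
  qed (use assms in \<open>auto simp: I_def layout_def intro: agree_on_refl\<close>)
qed

section \<open>Normalisation and the complete program\<close>

text \<open>The coefficient at 0 is saved because the weights need it after the second transform has
  overwritten its array.\<close>

definition invert_prog :: "real com" where
  "invert_prog = Seq (Store (scalar 2) (RLoad (NReg 4)))
     (For 6 (NReg 1) (Store (entry 3 6) (RDivide (real_const 1) (RLoad (entry 4 6)))))"

definition damping_prog :: "real com" where
  "damping_prog = Seq (Store (scalar 3) (real_const 1))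
     (For 6 (NReg 1) (Store (scalar 3)
       (RPlus (RLoad (scalar 3)) (RTimes (RLoad (entry 4 6)) (RLoad (entry 4 6))))))"

definition scale_row :: "real com" where
  "scale_row = For 7 (NReg 0) (Store (entry 9 7)
     (RTimes (RMinus (real_const 0) (real_const 2)) (RTimes (RLoad (scalar 4)) (RLoad (entry 9 7)))))"

text \<open>Signs and heights are multiplied in place by the row factor, so the results already lie
  where \<open>out_mat\<close> and \<open>out_vec\<close> read them.\<close>

definition scale_prog :: "real com" where
  "scale_prog = Seq (Assign 9 (NConst 0)) (For 6 (NReg 1)
     (Seq (Store (scalar 4) (RExp (RDivide
         (RLn (RDivide (RPlus (real_const 1) (RDivide (RLoad (entry 4 6)) (RLoad (scalar 3))))
           (RLoad (scalar 2))))
         (RLoad (scalar 0)))))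
     (Seq (Store (entry 2 6) (RTimes (RLoad (scalar 4)) (RLoad (entry 2 6))))
     (Seq scale_row (Assign 9 (NPlus (NReg 9) (NReg 0)))))))"

lemma runs_invert:
  assumes "layout k D s" "\<forall>j<D. snd s (D * k + 2 * D + j) = h j" "0 < D"
  shows "runs invert_prog s (D * 3 + 3)
    (\<lambda>t. layout k D t \<and> (\<forall>j<D. snd t (D * k + D + j) = 1 / h j) \<and>
      snd t (D * k + 3 * D + 2) = h 0 \<and>
      agree_on (- ({D * k + D..<D * k + 2 * D} \<union> {D * k + 3 * D + 2})) s t)"
proof -
  define A where "A = - ({D * k + D..<D * k + 2 * D} \<union> {D * k + 3 * D + 2})"
  define I where "I m t \<longleftrightarrow> layout k D t \<and> fst t 6 = m \<and>
      (\<forall>j<m. snd t (D * k + D + j) = 1 / h j) \<and> snd t (D * k + 3 * D + 2) = h 0 \<and> agree_on A s t"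
    for m :: nat and t :: state
  have 0: "snd s (D * k + 2 * D) = h 0" using assms(2,3) by (auto dest: spec[of _ 0])
  show ?thesis
    unfolding invert_prog_def A_def[symmetric]
  proof (rule runs_Seq_Store, simp, rule runs_For[where I = I and n = D and B = 1])
    fix m t
    assume t: "I m t"
    then show "fst t 6 = m \<and> nval (NReg 1) t = D" by (simp add: I_def layout_def)
    assume "m < D"
    have "D * k + 2 * D + m \<in> A" using \<open>m < D\<close> by (simp add: A_def)
    then have "snd t (D * k + 2 * D + m) = h m"
      using t assms(2) \<open>m < D\<close> agree_onD unfolding I_def by metis
    moreover have "agree_on A s ((fst t)(6 := Suc m), (snd t)(D * k + D + m := 1 / h m))"
      using t \<open>m < D\<close> by (intro agree_on_upd) (auto simp: I_def A_def)
    ultimately show "runs (Store (entry 3 6) (RDivide (real_const 1) (RLoad (entry 4 6)))) t 1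
         (\<lambda>s'. I (Suc m) ((fst s')(6 := Suc (fst s' 6)), snd s'))"
      using t \<open>m < D\<close> by (intro runs_Store) (auto simp: I_def layout_def less_Suc_eq)
  qed (use assms 0 in \<open>auto simp: I_def layout_def A_def agree_on_def\<close>)
qed

lemma runs_damping:
  assumes "layout k D s" "\<forall>i<D. snd s (D * k + 2 * D + i) = h i"
  shows "runs damping_prog s (D * 3 + 3)
    (\<lambda>t. layout k D t \<and> snd t (D * k + 3 * D + 3) = 1 + (\<Sum>i<D. h i * h i) \<and>
      agree_on (- {D * k + 3 * D + 3}) s t)"
proof -
  define A where "A = - {D * k + 3 * D + 3}"
  define I where "I m t \<longleftrightarrow> layout k D t \<and> fst t 6 = m \<and>
      snd t (D * k + 3 * D + 3) = 1 + (\<Sum>i<m. h i * h i) \<and> agree_on A s t"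
    for m :: nat and t :: state
  show ?thesis
    unfolding damping_prog_def A_def[symmetric]
  proof (rule runs_Seq_Store, simp, rule runs_For[where I = I and n = D and B = 1])
    fix m t
    assume t: "I m t"
    then show "fst t 6 = m \<and> nval (NReg 1) t = D" by (simp add: I_def layout_def)
    assume "m < D"
    have "D * k + 2 * D + m \<in> A" using \<open>m < D\<close> by (simp add: A_def)
    then have "snd t (D * k + 2 * D + m) = h m"
      using t assms(2) \<open>m < D\<close> agree_onD unfolding I_def by metis
    moreover have "agree_on A s ((fst t)(6 := Suc m),
        (snd t)(D * k + 3 * D + 3 := 1 + (\<Sum>i<Suc m. h i * h i)))"
      using t by (intro agree_on_upd) (auto simp: I_def A_def)
    ultimately show "runs (Store (scalar 3)
         (RPlus (RLoad (scalar 3)) (RTimes (RLoad (entry 4 6)) (RLoad (entry 4 6))))) t 1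
         (\<lambda>s'. I (Suc m) ((fst s')(6 := Suc (fst s' 6)), snd s'))"
      using t \<open>m < D\<close> by (intro runs_Store) (auto simp: I_def layout_def add.assoc)
  qed (use assms in \<open>auto simp: I_def layout_def A_def agree_on_def\<close>)
qed

lemma runs_scale_row:
  assumes "layout k D t" "i < D" "fst t 9 = i * k"
  shows "runs scale_row t (k * 3 + 2)
    (\<lambda>u. u = ((fst t)(7 := k), \<lambda>a. if i * k \<le> a \<and> a < i * k + k
      then - 2 * snd t (D * k + 3 * D + 4) * snd t a else snd t a))"
  unfolding scale_row_def
proof (rule runs_For[where n = k and B = 1 and I = "\<lambda>b u. u = ((fst t)(7 := b),
      \<lambda>a. if i * k \<le> a \<and> a < i * k + b then - 2 * snd t (D * k + 3 * D + 4) * snd t a else snd t a)"])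
  fix b u
  assume u: "u = ((fst t)(7 := b),
      \<lambda>a. if i * k \<le> a \<and> a < i * k + b then - 2 * snd t (D * k + 3 * D + 4) * snd t a else snd t a)"
  then show "fst u 7 = b \<and> nval (NReg 0) u = k" using assms(1) by (simp add: layout_def)
  assume "b < k"
  with assms(2) have "i * k + b < D * k" by (rule index_less)
  then show "runs (Store (entry 9 7)
     (RTimes (RMinus (real_const 0) (real_const 2)) (RTimes (RLoad (scalar 4)) (RLoad (entry 9 7))))) u 1
       (\<lambda>s'. ((fst s')(7 := Suc (fst s' 7)), snd s') =
         ((fst t)(7 := Suc b), \<lambda>a. if i * k \<le> a \<and> a < i * k + Suc b
           then - 2 * snd t (D * k + 3 * D + 4) * snd t a else snd t a))"
    using assms by (intro runs_Store) (auto simp: u layout_def fun_eq_iff)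
qed (auto simp: fun_eq_iff)

lemma runs_scale:
  assumes "layout k D s" "sign_table k D s" "\<forall>i<D. snd s (D * k + i) = h i"
    "\<forall>i<D. snd s (D * k + 2 * D + i) = g i" "\<forall>i<D. (1 + g i / M) / L > 0"
    "snd s (D * k + 3 * D) = p" "snd s (D * k + 3 * D + 2) = L" "snd s (D * k + 3 * D + 3) = M"
  shows "runs scale_prog s (D * (k * 3 + 7) + 3)
    (\<lambda>t. (\<forall>i<D. \<forall>b<k. snd t (i * k + b) = - 2 * exp (ln ((1 + g i / M) / L) / p) * bsign i b) \<and>
      (\<forall>i<D. snd t (D * k + i) = exp (ln ((1 + g i / M) / L) / p) * h i))"
proof -
  define c where "c i = exp (ln ((1 + g i / M) / L) / p)" for i
  define I where "I m t \<longleftrightarrow> layout k D t \<and> fst t 6 = m \<and> fst t 9 = m * k \<and>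
      (\<forall>i<D. \<forall>b<k. snd t (i * k + b) = (if i < m then - 2 * c i else 1) * bsign i b) \<and>
      (\<forall>i<D. snd t (D * k + i) = (if i < m then c i else 1) * h i) \<and>
      (\<forall>a\<ge>D * k + D. a \<noteq> D * k + 3 * D + 4 \<longrightarrow> snd t a = snd s a)"
    for m :: nat and t :: state
  show ?thesis
    unfolding scale_prog_def
  proof (rule runs_Seq_Assign, simp, rule runs_For[where I = I and n = D and B = "k * 3 + 5"])
    fix i t
    assume t: "I i t"
    then show "fst t 6 = i \<and> nval (NReg 1) t = D" by (simp add: I_def layout_def)
    assume "i < D"
    have regs: "fst t 0 = k" "fst t 2 = D * k" "fst t 4 = D * k + 2 * D" "fst t 5 = D * k + 3 * D"
        "fst t 6 = i" "fst t 9 = i * k" "snd t (D * k + i) = h i"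
        "snd t (D * k + 2 * D + i) = g i" "snd t (D * k + 3 * D) = p"
        "snd t (D * k + 3 * D + 2) = L" "snd t (D * k + 3 * D + 3) = M"
      using t assms \<open>i < D\<close> by (auto simp: I_def layout_def)
    \<comment> \<open>A positive weight excludes both the zero case of \<open>RLn\<close> and the
      effect of its absolute value.\<close>
    have wt: "(1 + g i / M) / L > 0" using assms(5) \<open>i < D\<close> by blast
    then have c: "exp ((if (1 + g i / M) / L = 0 then 0 else ln \<bar>(1 + g i / M) / L\<bar>) / p) = c i"
      unfolding c_def by (simp only: abs_of_pos less_imp_neq[symmetric] if_False)
    let ?m = "(snd t)(D * k + 3 * D + 4 := c i, D * k + i := c i * h i)"
    let ?u = "((fst t)(7 := k), \<lambda>a. if i * k \<le> a \<and> a < i * k + k then - 2 * c i * ?m a else ?m a)"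
    have "?m (D * k + 3 * D + 4) = c i" using \<open>i < D\<close> by simp
    moreover have "layout k D (fst t, ?m)" "fst (fst t, ?m) 9 = i * k"
      using t by (auto simp: I_def layout_def)
    ultimately have row: "runs scale_row (fst t, ?m) (k * 3 + 2) (\<lambda>u. u = ?u)"
      using runs_scale_row[of k D "(fst t, ?m)" i] \<open>i < D\<close> by (simp only: fst_conv snd_conv)
    \<comment> \<open>Scaling is described by an interval of addresses; it contains cells of row
      \<open>i\<close> only.\<close>
    have in_row: "i * k \<le> j * k + b \<and> j * k + b < i * k + k \<longleftrightarrow> j = i" if "b < k" for j b
    proof
      assume *: "i * k \<le> j * k + b \<and> j * k + b < i * k + k"
      then have "i * k < Suc j * k" "j * k < Suc i * k" using that by auto
      then have "i < Suc j" "j < Suc i" by (simp_all only: mult_less_cancel2)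
      then show "j = i" by simp
    qed (use that in simp)
    have less: "i * k + k \<le> D * k" using \<open>i < D\<close> by (metis Suc_leI mult_Suc mult_le_mono1 add.commute)
    have upd: "I (Suc i) ((fst ?u)(9 := i * k + k, 6 := Suc i), snd ?u)"
    proof -
      have "snd ?u (j * k + b) = (if j < Suc i then - 2 * c j else 1) * bsign j b"
        if "j < D" "b < k" for j b
        using t that index_less[OF that] in_row[OF that(2), of j]
        by (auto simp: I_def less_Suc_eq)
      moreover have "snd ?u (D * k + j) = (if j < Suc i then c j else 1) * h j" if "j < D" for j
        using t that less by (auto simp: I_def less_Suc_eq)
      moreover have "snd ?u a = snd s a" if "D * k + D \<le> a" "a \<noteq> D * k + 3 * D + 4" for a
        using t that less \<open>i < D\<close> by (auto simp: I_def)
      ultimately show ?thesis using t unfolding I_def by (auto simp: layout_def)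
    qed
    have store: "(fst t, (snd t)(D * k + 3 * D + 4 := c i)) =
      (fst t, (snd t)(nval (scalar 4) t := rval (RExp (RDivide
         (RLn (RDivide (RPlus (real_const 1) (RDivide (RLoad (entry 4 6)) (RLoad (scalar 3))))
           (RLoad (scalar 2))))
         (RLoad (scalar 0)))) t))"
      by (simp only: nval.simps rval.simps regs of_nat_1 add_0_right c)
    show "runs (Seq (Store (scalar 4) (RExp (RDivide
         (RLn (RDivide (RPlus (real_const 1) (RDivide (RLoad (entry 4 6)) (RLoad (scalar 3))))
           (RLoad (scalar 2))))
         (RLoad (scalar 0)))))
     (Seq (Store (entry 2 6) (RTimes (RLoad (scalar 4)) (RLoad (entry 2 6))))
     (Seq scale_row (Assign 9 (NPlus (NReg 9) (NReg 0)))))) t (k * 3 + 5)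
       (\<lambda>s'. I (Suc i) ((fst s')(6 := Suc (fst s' 6)), snd s'))"
    proof (rule runs_Seq_Store, simp, fold store, rule runs_Seq_Store, simp, rule runs_Seq_trans)
      show "runs scale_row (fst (fst t, (snd t)(D * k + 3 * D + 4 := c i)),
          (snd (fst t, (snd t)(D * k + 3 * D + 4 := c i)))
            (nval (entry 2 6) (fst t, (snd t)(D * k + 3 * D + 4 := c i)) :=
              rval (RTimes (RLoad (scalar 4)) (RLoad (entry 2 6)))
                (fst t, (snd t)(D * k + 3 * D + 4 := c i)))) (k * 3 + 2) (\<lambda>u. u = ?u)"
        using row \<open>i < D\<close> by (simp add: regs)
      fix u
      assume u: "u = ?u"
      show "runs (Assign 9 (NPlus (NReg 9) (NReg 0))) u (k * 3 + 5 - 1 - 1 - (k * 3 + 2))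
         (\<lambda>s'. I (Suc i) ((fst s')(6 := Suc (fst s' 6)), snd s'))"
        using upd unfolding u by (intro runs_Assign) (simp_all add: regs)
    qed simp
  next
    show "D * (k * 3 + 5 + 2) + 2 \<le> D * (k * 3 + 7) + 3 - 1" by simp
  qed (use assms in \<open>auto simp: I_def layout_def sign_table_def c_def\<close>)
qed

section \<open>Composition and running time\<close>

definition parallelepiped_prog :: "real \<Rightarrow> real com" where
  "parallelepiped_prog p0 =
     Seq (setup_prog p0) (Seq sign_prog (Seq height_prog (Seq transform_prog (Seq invert_prog
       (Seq transform_prog (Seq damping_prog scale_prog))))))"

definition parallelepiped_time :: "nat \<Rightarrow> nat \<Rightarrow> nat" where
  "parallelepiped_time k D = (6 * k + 10) + ((k * (D * 5 + 7) + 4) + ((D * (k * 3 + 7) + 3) +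
     ((D * (D * (k * 3 + 7) + 7) + 3) + ((D * 3 + 3) + ((D * (D * (k * 3 + 7) + 7) + 3) +
     ((D * 3 + 3) + (D * (k * 3 + 7) + 3)))))))"

lemma runs_Seq_sum:
  assumes "runs c1 s B1 P" "\<And>s'. P s' \<Longrightarrow> runs c2 s' B2 Q"
  shows "runs (Seq c1 c2) s (B1 + B2) Q"
  by (rule runs_Seq[OF runs_mono[OF assms(1) order_refl assms(2)] order_refl])

lemma runs_parallelepiped:
  assumes "fst s 0 = k"
  shows "runs (parallelepiped_prog p0) s (parallelepiped_time k (2 ^ k))
    (\<lambda>t. (\<forall>i<2 ^ k. \<forall>b<k. snd t (i * k + b) = - 2 * scale (p0 + snd s 0) k i * bsign i b) \<and>
      (\<forall>i<2 ^ k. snd t (2 ^ k * k + i) = scale (p0 + snd s 0) k i * height k i))"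
proof -
  define D where "D = (2 ^ k :: nat)"
  define p where "p = p0 + snd s 0"
  define L where "L = height_transform p k"
  define W where "W = inverse_weight p k"
  \<comment> \<open>The data that every stage between the heights and the final scaling
    preserves.\<close>
  define base where "base t \<longleftrightarrow> layout k D t \<and> sign_table k D t \<and>
    (\<forall>i<D. snd t (D * k + i) = height k i) \<and> snd t (D * k + 3 * D) = p" for t
  have "0 < D" by (simp add: D_def)
  have L: "L = (\<lambda>j. \<Sum>i<D. walsh k i j * height k i powr p)"
    by (simp add: L_def D_def walsh_transform_def fun_eq_iff)
  have W: "W = (\<lambda>j. \<Sum>i<D. walsh k i j * (1 / L i))"
    by (simp add: W_def L_def D_def inverse_weight_def fun_eq_iff
        walsh_transform_def[of k "\<lambda>l. 1 / height_transform p k l"])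
  have M: "damping p k = 1 + (\<Sum>i<D. W i * W i)"
    by (simp add: damping_def W_def D_def)
  have pos: "\<forall>i<D. (1 + W i / damping p k) / L 0 > 0"
    using weight_pos[of _ k p] unfolding weight_def W_def L_def D_def by blast
  have scale: "scale p k i = exp (ln ((1 + W i / damping p k) / L 0) / p)" for i
    unfolding scale_def weight_def W_def L_def ..
  have base_agree: "base u"
    if "base t" "layout k D u" "agree_on A t u" "{..<D * k + D} \<union> {D * k + 3 * D} \<subseteq> A" for A t u
  proof -
    from that(4) have "\<And>i. i < D \<Longrightarrow> D * k + i \<in> A" by auto
    moreover have "D * k + 3 * D \<in> A" "{..<D * k} \<subseteq> A" using that(4) by auto
    ultimately show ?thesis
      using that(1,2) agree_onD[OF that(3)] sign_table_agree[OF _ that(3)] by (simp add: base_def)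
  qed

  have setup_ok: "runs (setup_prog p0) s (6 * k + 10)
      (\<lambda>t. layout k D t \<and> snd t (D * k + 3 * D) = p)"
    using runs_setup[OF assms] by (simp add: D_def p_def)
  have sign: "runs sign_prog t (k * (D * 5 + 7) + 4)
      (\<lambda>t. layout k D t \<and> sign_table k D t \<and> snd t (D * k + 3 * D) = p)"
    if "layout k D t \<and> snd t (D * k + 3 * D) = p" for t
    by (rule runs_mono[OF runs_sign order_refl]) (use that in auto)
  have height: "runs height_prog t (D * (k * 3 + 7) + 3)
      (\<lambda>t. base t \<and> (\<forall>i<D. snd t (D * k + D + i) = height k i powr p))"
    if "layout k D t \<and> sign_table k D t \<and> snd t (D * k + 3 * D) = p" for t
    by (rule runs_mono[OF runs_height order_refl]) (use that in \<open>auto simp: base_def\<close>)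
  have transform1: "runs transform_prog t (D * (D * (k * 3 + 7) + 7) + 3)
      (\<lambda>t. base t \<and> (\<forall>j<D. snd t (D * k + 2 * D + j) = L j))"
    if "base t \<and> (\<forall>i<D. snd t (D * k + D + i) = height k i powr p)" for t
  proof (rule runs_mono[OF runs_transform order_refl])
    show "layout k D t" "sign_table k D t" "\<forall>i<D. snd t (D * k + D + i) = height k i powr p"
      using that by (auto simp: base_def)
    fix u
    assume u: "layout k D u \<and>
      (\<forall>j<D. snd u (D * k + 2 * D + j) = (\<Sum>i<D. walsh k i j * height k i powr p)) \<and>
      agree_on (- ({D * k + 2 * D..<D * k + 3 * D} \<union> {D * k + 3 * D + 1})) t u"
    then have "base u" using that by (elim conjE) (rule base_agree, auto)
    with u show "base u \<and> (\<forall>j<D. snd u (D * k + 2 * D + j) = L j)" by (simp add: L)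
  qed
  have invert: "runs invert_prog t (D * 3 + 3)
      (\<lambda>t. base t \<and> (\<forall>j<D. snd t (D * k + D + j) = 1 / L j) \<and> snd t (D * k + 3 * D + 2) = L 0)"
    if "base t \<and> (\<forall>j<D. snd t (D * k + 2 * D + j) = L j)" for t
  proof (rule runs_mono[OF runs_invert order_refl])
    show "layout k D t" "\<forall>j<D. snd t (D * k + 2 * D + j) = L j" "0 < D"
      using that \<open>0 < D\<close> by (auto simp: base_def)
    fix u
    assume u: "layout k D u \<and> (\<forall>j<D. snd u (D * k + D + j) = 1 / L j) \<and>
      snd u (D * k + 3 * D + 2) = L 0 \<and>
      agree_on (- ({D * k + D..<D * k + 2 * D} \<union> {D * k + 3 * D + 2})) t u"
    then have "base u" using that \<open>0 < D\<close> by (elim conjE) (rule base_agree, auto)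
    with u show "base u \<and> (\<forall>j<D. snd u (D * k + D + j) = 1 / L j) \<and>
        snd u (D * k + 3 * D + 2) = L 0" by simp
  qed
  have transform2: "runs transform_prog t (D * (D * (k * 3 + 7) + 7) + 3)
      (\<lambda>t. base t \<and> (\<forall>j<D. snd t (D * k + 2 * D + j) = W j) \<and> snd t (D * k + 3 * D + 2) = L 0)"
    if "base t \<and> (\<forall>j<D. snd t (D * k + D + j) = 1 / L j) \<and> snd t (D * k + 3 * D + 2) = L 0" for t
  proof (rule runs_mono[OF runs_transform order_refl])
    show "layout k D t" "sign_table k D t" "\<forall>i<D. snd t (D * k + D + i) = 1 / L i"
      using that by (auto simp: base_def)
    fix u
    assume u: "layout k D u \<and>
      (\<forall>j<D. snd u (D * k + 2 * D + j) = (\<Sum>i<D. walsh k i j * (1 / L i))) \<and>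
      agree_on (- ({D * k + 2 * D..<D * k + 3 * D} \<union> {D * k + 3 * D + 1})) t u"
    then have "base u" using that by (elim conjE) (rule base_agree, auto)
    moreover have "snd u (D * k + 3 * D + 2) = snd t (D * k + 3 * D + 2)"
      using u by (elim conjE) (erule agree_onD, simp)
    ultimately show "base u \<and> (\<forall>j<D. snd u (D * k + 2 * D + j) = W j) \<and>
        snd u (D * k + 3 * D + 2) = L 0" using u that by (simp add: W)
  qed
  have damping: "runs damping_prog t (D * 3 + 3)
      (\<lambda>t. base t \<and> (\<forall>j<D. snd t (D * k + 2 * D + j) = W j) \<and>
        snd t (D * k + 3 * D + 2) = L 0 \<and> snd t (D * k + 3 * D + 3) = damping p k)"
    if "base t \<and> (\<forall>j<D. snd t (D * k + 2 * D + j) = W j) \<and> snd t (D * k + 3 * D + 2) = L 0" for t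
  proof (rule runs_mono[OF runs_damping order_refl])
    show "layout k D t" "\<forall>j<D. snd t (D * k + 2 * D + j) = W j"
      using that by (auto simp: base_def)
    fix u
    assume u: "layout k D u \<and> snd u (D * k + 3 * D + 3) = 1 + (\<Sum>i<D. W i * W i) \<and>
      agree_on (- {D * k + 3 * D + 3}) t u"
    then have "base u" using that by (elim conjE) (rule base_agree, auto)
    moreover have "snd u a = snd t a" if "a \<noteq> D * k + 3 * D + 3" for a
      using u that by (elim conjE) (erule agree_onD, simp)
    ultimately show "base u \<and> (\<forall>j<D. snd u (D * k + 2 * D + j) = W j) \<and>
        snd u (D * k + 3 * D + 2) = L 0 \<and> snd u (D * k + 3 * D + 3) = damping p k"
      using u that by (simp add: M)
  qed
  have scaling: "runs scale_prog t (D * (k * 3 + 7) + 3)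
      (\<lambda>t. (\<forall>i<D. \<forall>b<k. snd t (i * k + b) = - 2 * scale p k i * bsign i b) \<and>
        (\<forall>i<D. snd t (D * k + i) = scale p k i * height k i))"
    if "base t \<and> (\<forall>j<D. snd t (D * k + 2 * D + j) = W j) \<and>
        snd t (D * k + 3 * D + 2) = L 0 \<and> snd t (D * k + 3 * D + 3) = damping p k" for t
    unfolding scale by (rule runs_scale[OF _ _ _ _ pos]) (use that in \<open>auto simp: base_def\<close>)
  show ?thesis
    unfolding parallelepiped_prog_def parallelepiped_time_def D_def[symmetric] p_def[symmetric]
    by (rule runs_Seq_sum[OF setup_ok] runs_Seq_sum[OF sign] runs_Seq_sum[OF height]
        runs_Seq_sum[OF transform1] runs_Seq_sum[OF invert] runs_Seq_sum[OF transform2]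
        runs_Seq_sum[OF damping] scaling | assumption)+
qed

text \<open>The transforms dominate: \<open>D * D\<close> Walsh values with \<open>k \<le> D\<close>
  factors each.\<close>

lemma parallelepiped_time_le:
  assumes "k \<le> D" "1 \<le> D"
  shows "parallelepiped_time k D \<le> 111 * D ^ 3"
proof -
  have *: "D \<le> D * D" "D * D \<le> D * (D * D)" using assms(2) by auto
  have **: "k * D \<le> D * D" "k * (D * D) \<le> D * (D * D)" using assms(1) by auto
  have "parallelepiped_time k D = 13 * k + 11 * (k * D) + 6 * (k * (D * D)) + 34 * D +
      14 * (D * D) + 32"
    by (simp add: parallelepiped_time_def algebra_simps)
  \<comment> \<open>Every monomial is at most \<open>D ^ 3\<close>, and the coefficients add up to
    110.\<close>
  also have "\<dots> \<le> 111 * (D * (D * D))"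
    using * ** assms by linarith
  finally show ?thesis by (simp add: power3_eq_cube)
qed

lemma com_reals_For: "com_reals (For i a c) = com_reals c"
  by (simp add: For_def)

lemma com_reals_parallelepiped_prog: "com_reals (parallelepiped_prog p0) = {p0}"
  by (simp add: parallelepiped_prog_def setup_prog_def sign_prog_def sign_column_def sign_entry_def
      height_prog_def height_row_def transform_prog_def transform_row_def walsh_prog_def
      invert_prog_def damping_prog_def scale_prog_def scale_row_def com_reals_For)

theorem theorem4p14:
  fixes p0 :: real and \<delta> :: "nat \<Rightarrow> real" and K :: "real set"
  assumes "p0 \<ge> 1"
    and "\<And>n. n > 0 \<Longrightarrow> \<delta> n \<noteq> 0"
    and "efficiently_computable K \<delta>"
    and "\<delta> \<longlonglongrightarrow> 0"
  shows "\<exists>(A :: real com) (e :: nat) (N :: nat).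
           com_reals A \<subseteq> insert p0 K \<and>
           (\<forall>k n. k \<ge> 2 \<and> n > 0 \<and> n \<ge> N \<longrightarrow>
              (\<exists>T s. exec A (init_state [k, n]) T s \<and>
                     T \<le> e * (n + 2 ^ k) ^ e \<and>
                     isolating_parallelepiped (p0 + \<delta> n) k
                       (out_mat (2 ^ k) k s) (out_vec (2 ^ k) k s)))"
proof -
  from noninteger_perturbation[OF assms(1,2,4)] obtain N where
    N: "\<And>n. n > 0 \<Longrightarrow> n \<ge> N \<Longrightarrow> p0 + \<delta> n \<notin> \<int> \<and> p0 + \<delta> n > 0" by blast
  from assms(3) obtain A e where A: "com_reals A \<subseteq> K"
    "\<And>n. n > 0 \<Longrightarrow> \<exists>T s. exec A (init_state [n]) T s \<and> T \<le> e * n ^ e \<and> out_real s = \<delta> n"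
    unfolding efficiently_computable_def by blast
  \<comment> \<open>Register \<open>R\<close> is out of reach of \<open>A\<close>, and
    \<open>2 \<le> R\<close> keeps it apart from the input registers 0 and 1.\<close>
  define R where "R = max 2 (com_bound A)"
  have R: "com_bound A \<le> R" "2 \<le> R" by (simp_all add: R_def)
  \<comment> \<open>Save \<open>k\<close>, present \<open>n\<close> as the only input of
    \<open>A\<close>, run \<open>A\<close>, and restore \<open>k\<close>.\<close>
  define P where "P = Seq (Assign R (NReg 0)) (Seq (Assign 0 (NReg 1)) (Seq (Assign 1 (NConst 0))
    (Seq A (Seq (Assign 0 (NReg R)) (parallelepiped_prog p0)))))"
  have reals: "com_reals P \<subseteq> insert p0 K"
    using A(1) by (auto simp: P_def com_reals_parallelepiped_prog)
  \<comment> \<open>As a coefficient: \<open>e\<close> for \<open>A\<close>, 111 for the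
    construction and 4 for the assignments in \<open>P\<close>. As an exponent it exceeds both
    \<open>e\<close> and 3.\<close>
  define e' where "e' = e + 115"
  have main: "\<exists>T s. exec P (init_state [k, n]) T s \<and> T \<le> e' * (n + 2 ^ k) ^ e' \<and>
      isolating_parallelepiped (p0 + \<delta> n) k (out_mat (2 ^ k) k s) (out_vec (2 ^ k) k s)"
    if "n > 0" "n \<ge> N" for k n
  proof -
    let ?p = "p0 + \<delta> n"
    define g where "g = (\<lambda>i. if i = R then k else 0)"
    obtain T1 s1 where T1: "exec A (init_state [n]) T1 s1" "T1 \<le> e * n ^ e" "out_real s1 = \<delta> n"
      using A(2)[OF \<open>n > 0\<close>] by blast
    define s2 where "s2 = with_regs R g s1"
    have "runs A (with_regs R g (init_state [n])) (e * n ^ e) (\<lambda>t. t = s2)"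
      unfolding s2_def by (rule runsI[OF exec_with_regs[OF T1(1) R(1)] T1(2)]) simp
    \<comment> \<open>After three assignments the state is the initial state of \<open>A\<close> on
      input \<open>n\<close>, except that register \<open>R\<close> holds \<open>k\<close>.\<close>
    moreover have start: "with_regs R g (init_state [n]) =
        ((fst (init_state [k, n]))(R := k, 0 := n, 1 := 0), snd (init_state [k, n]))"
      using R(2) by (auto simp: with_regs_def init_state_def g_def fun_eq_iff nth_Cons split: nat.splits)
    ultimately have runA: "runs A
        ((fst (init_state [k, n]))(R := k, 0 := n, 1 := 0), snd (init_state [k, n]))
        (e * n ^ e) (\<lambda>t. t = s2)" by simp
    have s2: "fst s2 R = k" "snd s2 0 = \<delta> n"
      using T1(3) by (simp_all add: s2_def with_regs_def g_def out_real_def)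
    have in0: "fst (init_state [k, n]) 0 = k" "fst (init_state [k, n]) 1 = n"
      by (simp_all add: init_state_def)
    have runP: "runs (parallelepiped_prog p0) ((fst s2)(0 := k), snd s2) (parallelepiped_time k (2 ^ k))
      (\<lambda>t. (\<forall>i<2 ^ k. \<forall>b<k. snd t (i * k + b) = - 2 * scale ?p k i * bsign i b) \<and>
        (\<forall>i<2 ^ k. snd t (2 ^ k * k + i) = scale ?p k i * height k i))"
      using runs_parallelepiped[of "((fst s2)(0 := k), snd s2)" k p0] s2 by simp
    have "runs P (init_state [k, n]) (1 + (1 + (1 + (e * n ^ e + (1 + parallelepiped_time k (2 ^ k))))))
      (\<lambda>t. (\<forall>i<2 ^ k. \<forall>b<k. snd t (i * k + b) = - 2 * scale ?p k i * bsign i b) \<and>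
        (\<forall>i<2 ^ k. snd t (2 ^ k * k + i) = scale ?p k i * height k i))"
      (is "runs _ _ _ ?Q")
    proof -
      have "runs (Seq A (Seq (Assign 0 (NReg R)) (parallelepiped_prog p0)))
          ((fst (init_state [k, n]))(R := k, 0 := n, 1 := 0), snd (init_state [k, n]))
          (e * n ^ e + (1 + parallelepiped_time k (2 ^ k))) ?Q"
      proof (rule runs_Seq_sum[OF runA])
        fix t
        assume "t = s2"
        with runP s2(1) show "runs (Seq (Assign 0 (NReg R)) (parallelepiped_prog p0)) t
            (1 + parallelepiped_time k (2 ^ k)) ?Q"
          by (intro runs_Seq_Assign) simp_all
      qed
      moreover have "1 \<noteq> R" using R(2) by simp
      ultimately show ?thesis
        unfolding P_def using in0 by (intro runs_Seq_Assign) simp_all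
    qed
    then obtain T s where T: "exec P (init_state [k, n]) T s"
        "T \<le> 1 + (1 + (1 + (e * n ^ e + (1 + parallelepiped_time k (2 ^ k)))))"
      and s: "\<forall>i<2 ^ k. \<forall>b<k. snd s (i * k + b) = - 2 * scale ?p k i * bsign i b"
        "\<forall>i<2 ^ k. snd s (2 ^ k * k + i) = scale ?p k i * height k i"
      by (rule runsE) blast
    have "T \<le> e' * (n + 2 ^ k) ^ e'"
    proof -
      let ?x = "n + 2 ^ k"
      have x: "1 \<le> ?x" using \<open>n > 0\<close> by simp
      have "n ^ e \<le> ?x ^ e" by (intro power_mono) auto
      also have "\<dots> \<le> ?x ^ e'" using x by (intro power_increasing) (auto simp: e'_def)
      finally have 1: "e * n ^ e \<le> e * ?x ^ e'" by simp
      have "(2 ^ k) ^ 3 \<le> ?x ^ 3" by (intro power_mono) auto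
      also have "\<dots> \<le> ?x ^ e'" using x by (intro power_increasing) (auto simp: e'_def)
      finally have 2: "parallelepiped_time k (2 ^ k) \<le> 111 * ?x ^ e'"
        using parallelepiped_time_le[of k "2 ^ k"] by (simp add: less_imp_le)
      have "1 \<le> ?x ^ e'" using x by (simp add: Suc_le_eq)
      moreover have "e' * ?x ^ e' = e * ?x ^ e' + 115 * ?x ^ e'"
        by (simp add: e'_def add_mult_distrib)
      ultimately show ?thesis using 1 2 T(2) by linarith
    qed
    moreover have "out_mat (2 ^ k) k s = mat (2 ^ k) k (\<lambda>(i, b). - 2 * scale ?p k i * bsign i b)"
      using s(1) by (intro eq_matI) (auto simp: out_mat_def)
    moreover have "out_vec (2 ^ k) k s = vec (2 ^ k) (\<lambda>i. scale ?p k i * height k i)"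
      using s(2) by (intro eq_vecI) (auto simp: out_vec_def)
    ultimately show ?thesis
      using isolating_parallelepiped_sign_matrix[of ?p k] N[OF that]
      by (intro exI[of _ T] exI[of _ s]) (simp add: T(1))
  qed
  show ?thesis
    by (rule exI[of _ P], rule exI[of _ e'], rule exI[of _ N]) (use reals main in blast)
qed

end
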